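(* Let $\mathbb{X},\mathbb{Y}\subset\mathbb{C}$ be bounded Lipschitz domains of finite connectivity. Suppose that $h\colon\overline{\mathbb{X}}\to\overline{\mathbb{Y}}$ is a monotone map onto $\overline{\mathbb{Y}}$ of Sobolev class $\mathscr W^{1,2}(\mathbb{X},\mathbb{C})$ with positive Jacobian determinant $\det Dh>0$ almost everywhere in $\mathbb{X}$. Then: (i) the set $\mathbb{Y}_h=\{y\in h(\overline{\mathbb{X}}):h^{-1}(y)\text{ is a single point}\}$ has full measure in $\overline{\mathbb{Y}}$; (ii) there exists a set $\mathbb{X}_h\subset\mathbb{X}$ of full measure in $\mathbb{X}$ such that the restriction of $h$ to $\mathbb{X}_h$ is injective.
   Context: A continuous map $h\colon\overline{\mathbb{X}}\to\overline{\mathbb{Y}}$ is monotone (in the sense of Morrey) if the preimage $h^{-1}(C)$ of every continuum $C\subset\overline{\mathbb{Y}}$ is a continuum in $\overline{\mathbb{X}}$. *)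

theory Defs
  imports "HOL-Analysis.Analysis"
begin

definition continuum :: "'a::topological_space set \<Rightarrow> bool" where
  "continuum C \<longleftrightarrow> C \<noteq> {} \<and> compact C \<and> connected C"

definition morrey_monotone :: "('a::topological_space \<Rightarrow> 'b::topological_space) \<Rightarrow> 'a set \<Rightarrow> 'b set \<Rightarrow> bool" where
  "morrey_monotone h A B \<longleftrightarrow> continuous_on A h \<and> h ` A \<subseteq> B \<and>
     (\<forall>C. C \<subseteq> B \<and> continuum C \<longrightarrow> continuum {x \<in> A. h x \<in> C})"

definition domain :: "complex set \<Rightarrow> bool" where
  "domain X \<longleftrightarrow> open X \<and> connected X \<and> X \<noteq> {}"

definition lipschitz_domain :: "complex set \<Rightarrow> bool" where
  "lipschitz_domain X \<longleftrightarrow> domain X \<and>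
     (\<forall>p \<in> frontier X. \<exists>r>0. \<exists>u::complex. \<exists>g::real \<Rightarrow> real. \<exists>L.
        cmod u = 1 \<and> lipschitz_on L UNIV g \<and>
        X \<inter> ball p r = {z \<in> ball p r. Im (u * (z - p)) > g (Re (u * (z - p)))})"

text \<open>Finite connectivity: the complement has finitely many connected components
  (equivalently, finitely many boundary components).\<close>
definition finitely_connected :: "complex set \<Rightarrow> bool" where
  "finitely_connected X \<longleftrightarrow> finite (components (- X))"

coinductive smooth_fun :: "(complex \<Rightarrow> real) \<Rightarrow> bool" where
  "(\<forall>x. f differentiable (at x)) \<Longrightarrow>
   smooth_fun (\<lambda>x. frechet_derivative f (at x) 1) \<Longrightarrow>
   smooth_fun (\<lambda>x. frechet_derivative f (at x) \<i>) \<Longrightarrow> smooth_fun f"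

definition test_function :: "complex set \<Rightarrow> (complex \<Rightarrow> real) \<Rightarrow> bool" where
  "test_function X \<phi> \<longleftrightarrow> smooth_fun \<phi> \<and>
     compact (closure {x. \<phi> x \<noteq> 0}) \<and> closure {x. \<phi> x \<noteq> 0} \<subseteq> X"

definition L2_on :: "complex set \<Rightarrow> (complex \<Rightarrow> complex) \<Rightarrow> bool" where
  "L2_on X f \<longleftrightarrow> set_borel_measurable lebesgue X f \<and>
     set_integrable lebesgue X (\<lambda>z. (cmod (f z))\<^sup>2)"

definition weak_partial :: "complex set \<Rightarrow> complex \<Rightarrow> (complex \<Rightarrow> complex) \<Rightarrow> (complex \<Rightarrow> complex) \<Rightarrow> bool" where
  "weak_partial X e h g \<longleftrightarrow>
     (\<forall>\<phi>. test_function X \<phi> \<longrightarrow>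
        (LINT z:X|lebesgue. frechet_derivative \<phi> (at z) e *\<^sub>R h z)
          = - (LINT z:X|lebesgue. \<phi> z *\<^sub>R g z))"

definition sobolev_W12 :: "complex set \<Rightarrow> (complex \<Rightarrow> complex) \<Rightarrow> (complex \<Rightarrow> complex) \<Rightarrow> (complex \<Rightarrow> complex) \<Rightarrow> bool" where
  "sobolev_W12 X h g1 g2 \<longleftrightarrow> L2_on X h \<and> L2_on X g1 \<and> L2_on X g2 \<and>
     weak_partial X 1 h g1 \<and> weak_partial X \<i> h g2"

text \<open>Jacobian determinant det Dh = u_x v_y - u_y v_x where h = u + i v.\<close>
definition jacobian :: "(complex \<Rightarrow> complex) \<Rightarrow> (complex \<Rightarrow> complex) \<Rightarrow> complex \<Rightarrow> real" where
  "jacobian g1 g2 z = Re (g1 z) * Im (g2 z) - Re (g2 z) * Im (g1 z)"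

end

theory Submission
  imports Defs
begin

text \<open>
  Every fibre \<open>h\<inverse>(y)\<close> is connected, so it suffices to show that almost every fibre is totally
  disconnected. A Sobolev map is absolutely continuous on almost every line parallel to an axis,
  so the image of almost every such line is a rectifiable, hence null, set. By Fubini, for almost
  every \<open>y\<close> the fibre over \<open>y\<close> misses almost every horizontal and vertical line inside \<open>X\<close>; a fibre
  meeting \<open>X\<close> can then be trapped in arbitrarily small boxes and is a point. A nondegenerate fibre
  inside the boundary, which is locally a graph, meets a fixed countable set, so there are only
  countably many of those. This proves (i).

  For (ii) one needs that \<open>h\<close> pulls null sets back to null sets. The classical partial derivatives
  exist almost everywhere and agree with the weak ones. Sorting the points according to rational
  approximations of the derivatives and a uniform scale cuts \<open>X\<close>, up to a null set, into countably
  many pieces on which \<open>h\<close> has a Lipschitz inverse, because the Jacobian does not vanish.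
\<close>

section \<open>Lebesgue differentiation on the line\<close>

text \<open>Part (ii) is more than (i): a null set of exceptional values could have a preimage of
  positive area, and this is what the positive Jacobian excludes.

  The weak derivatives are known only through pairings with smooth functions of compact support.
  Products \<open>B s * A t\<close> of functions of one variable are enough: when the profiles tend
  to indicator functions, they give a fundamental theorem of calculus integrated over every closed
  rectangle inside \<open>X\<close>, and Lebesgue differentiation in \<open>s\<close> then yields it
  on almost every line. The profiles are built from exp(-1/x), because \<open>smooth_fun\<close>
  asks for derivatives of all orders.

  Two obstacles recur. Null sets depend on uncountably many parameters (rectangles, endpoints), so
  statements are proved for rational data and then extended by continuity or by covering. Fubini
  needs the exceptional set to be measurable in the plane; this comes from compactness of sets of
  pairs (line, value), and from a description of derivatives by rational difference quotients.

  All information on lines lives inside the open set \<open>X\<close>. On the frontier there is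
  none, hence the separate argument with graphs.\<close>

text \<open>Henstock's lemma bounds the total length of disjoint intervals on which the difference quotient
  is off by a fixed amount; Vitali's theorem covers the bad points by such intervals.\<close>
lemma integral_has_vector_derivative_ae:
  fixes f :: "real \<Rightarrow> 'b::euclidean_space"
  assumes f: "f integrable_on {a..b}"
  obtains N where "negligible N"
    "\<And>x. x \<in> {a<..<b} - N \<Longrightarrow> ((\<lambda>u. integral {a..u} f) has_vector_derivative f x) (at x)"
proof -
  \<comment> \<open>The point \<open>x\<close> may be an endpoint of the interval: at the end
    \<open>D\<close> is applied with \<open>u = x\<close> for increments to the right and with
    \<open>v = x\<close> for increments to the left.\<close>
  define D where "D x u v \<longleftrightarrow> a \<le> u \<and> u \<le> x \<and> x \<le> v \<and> v \<le> b \<and> u < v" for x u v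
  define B where "B k = {x \<in> {a<..<b}. \<forall>d>0. \<exists>u v. D x u v \<and> v - u < d \<and>
      norm ((v - u) *\<^sub>R f x - integral {u..v} f) > (v - u) / (real k + 1)}" for k
  have neg: "negligible (B k)" for k
    unfolding negligible_outer_le
  proof (intro allI impI)
    fix e :: real assume e: "e > 0"
    then have e': "e / (real k + 1) > 0" by simp
    obtain \<gamma> where \<gamma>: "gauge \<gamma>"
      and H: "\<And>p. \<lbrakk>p tagged_partial_division_of (cbox a b); \<gamma> fine p\<rbrakk> \<Longrightarrow>
             sum (\<lambda>(x,k). norm(measure lborel k *\<^sub>R f x - integral k f)) p < e / (real k + 1)"
      by (rule Henstock_lemma[of f a b "e / (real k + 1)"]) (use f e' in auto)
    \<comment> \<open>The bad intervals that are also fine for the gauge. A bad point lies in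
      arbitrarily short ones, since the gauge set at \<open>x\<close> is open. Vitali's theorem is
      about balls, so \<open>[u,v]\<close> is recast as the ball around its midpoint.\<close>
    define K where "K = {(x,u,v). D x u v \<and> {u..v} \<subseteq> \<gamma> x \<and>
      norm ((v - u) *\<^sub>R f x - integral {u..v} f) > (v - u) / (real k + 1)}"
    define c r where "c = (\<lambda>(x::real,u,v). (u+v)/2 :: real)" and "r = (\<lambda>(x::real,u,v). (v-u)/2 :: real)"
    have cb: "cball (c (x,u,v)) (r (x,u,v)) = {u..v}" for x u v
      by (auto simp: c_def r_def cball_eq_atLeastAtMost field_simps)
    have V: "\<exists>i. i \<in> K \<and> x \<in> cball (c i) (r i) \<and> r i < d" if x: "x \<in> B k" and d: "0 < d" for x d
    proof -
      have "open (\<gamma> x)" "x \<in> \<gamma> x" using \<gamma> by (auto simp: gauge_def)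
      then obtain d' where d': "d' > 0" "ball x d' \<subseteq> \<gamma> x" by (meson openE)
      have "min d d' > 0" using d d' by simp
      then obtain u v where uv: "D x u v" "v - u < min d d'"
        "norm ((v - u) *\<^sub>R f x - integral {u..v} f) > (v - u) / (real k + 1)"
        using x unfolding B_def by blast
      have "{u..v} \<subseteq> ball x d'" using uv by (auto simp: D_def dist_real_def)
      then have "(x,u,v) \<in> K" using uv d' by (auto simp: K_def)
      moreover have "x \<in> cball (c (x,u,v)) (r (x,u,v))" unfolding cb using uv by (auto simp: D_def)
      moreover have "r (x,u,v) < d" using uv d by (auto simp: r_def D_def)
      ultimately show ?thesis by blast
    qed
    have rp: "0 < r i" if "i \<in> K" for i
      using that by (auto simp: K_def r_def D_def)
    obtain C where C: "countable C" "C \<subseteq> K"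
       "pairwise (\<lambda>i j. disjnt (cball (c i) (r i)) (cball (c j) (r j))) C"
       "negligible(B k - (\<Union>i \<in> C. cball (c i) (r i)))"
      by (rule Vitali_covering_theorem_cballs[of K r "B k" c, OF rp V])
    \<comment> \<open>A finite disjoint subfamily, tagged by its points \<open>x\<close>, is a fine
      partial division. Henstock bounds its total error by \<open>e / (k + 1)\<close>, while every
      term exceeds its length divided by \<open>k + 1\<close>; hence the lengths add up to less than
      \<open>e\<close>.\<close>
    have fin: "measure lebesgue (\<Union>i\<in>F. cball (c i) (r i)) \<le> e" if F: "F \<subseteq> C" "finite F" for F
    proof -
      define g where "g = (\<lambda>(x::real,u::real,v::real). (x, {u..v}))"
      have FK: "F \<subseteq> K" using F C by auto
      have inj: "inj_on g F"
        using FK by (auto simp: inj_on_def g_def K_def D_def Icc_eq_Icc)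
      have "g ` F tagged_partial_division_of (cbox a b)"
        unfolding tagged_partial_division_of_def
      proof (intro conjI allI impI)
        show "finite (g ` F)" using F by simp
      next
        fix x k assume "(x,k) \<in> g ` F"
        then obtain u v where *: "(x,u,v) \<in> K" "k = {u..v}" using FK by (auto simp: g_def)
        then show "x \<in> k" "k \<subseteq> cbox a b" "\<exists>a b. k = cbox a b"
          by (auto simp: K_def D_def)
      next
        fix x1 k1 x2 k2
        assume A: "(x1, k1) \<in> g ` F \<and> (x2, k2) \<in> g ` F \<and> (x1, k1) \<noteq> (x2, k2)"
        obtain u1 v1 u2 v2 where *: "(x1,u1,v1) \<in> F" "(x2,u2,v2) \<in> F" "k1 = {u1..v1}" "k2 = {u2..v2}"
          using A by (auto simp: g_def)
        with A have "(x1,u1,v1) \<noteq> (x2,u2,v2)" by auto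
        with * F have "disjnt (cball (c (x1,u1,v1)) (r (x1,u1,v1))) (cball (c (x2,u2,v2)) (r (x2,u2,v2)))"
          by (intro pairwiseD[OF C(3)]) auto
        then have "k1 \<inter> k2 = {}" using * by (simp add: cb disjnt_def)
        then show "interior k1 \<inter> interior k2 = {}"
          using interior_subset by blast
      qed
      moreover have "\<gamma> fine (g ` F)"
        using FK by (auto simp: fine_def g_def K_def)
      ultimately have "sum (\<lambda>(x,k). norm(measure lborel k *\<^sub>R f x - integral k f)) (g ` F) < e / (real k + 1)"
        by (rule H)
      moreover have "sum (\<lambda>(x,k). norm(measure lborel k *\<^sub>R f x - integral k f)) (g ` F) =
          (\<Sum>(x,u,v)\<in>F. norm ((v - u) *\<^sub>R f x - integral {u..v} f))"
        unfolding sum.reindex[OF inj] o_def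
      proof (intro sum.cong refl)
        fix i assume "i \<in> F"
        then show "(case g i of (x, k) \<Rightarrow> norm (measure lborel k *\<^sub>R f x - integral k f)) =
           (case i of (x, u, v) \<Rightarrow> norm ((v - u) *\<^sub>R f x - integral {u..v} f))"
          using FK by (auto simp: g_def K_def D_def)
      qed
      ultimately have s: "(\<Sum>(x,u,v)\<in>F. norm ((v - u) *\<^sub>R f x - integral {u..v} f)) < e / (real k + 1)"
        by simp
      have "(\<Sum>(x,u,v)\<in>F. (v - u) / (real k + 1)) \<le> (\<Sum>(x,u,v)\<in>F. norm ((v - u) *\<^sub>R f x - integral {u..v} f))"
        using FK by (intro sum_mono) (auto simp: K_def)
      with s have "(\<Sum>(x,u,v)\<in>F. (v - u) / (real k + 1)) < e / (real k + 1)" by linarith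
      then have "(\<Sum>(x,u,v)\<in>F. (v - u)) / (real k + 1) < e / (real k + 1)"
        by (simp add: sum_divide_distrib split_def)
      then have le: "(\<Sum>(x,u,v)\<in>F. (v - u)) < e"
        by (simp add: divide_less_cancel)
      have "measure lebesgue (\<Union>i\<in>F. cball (c i) (r i)) \<le> (\<Sum>i\<in>F. measure lebesgue (cball (c i) (r i)))"
        using F by (intro measure_UNION_le) auto
      also have "\<dots> = (\<Sum>(x,u,v)\<in>F. (v - u))"
      proof (intro sum.cong refl)
        fix i assume "i \<in> F"
        then show "measure lebesgue (cball (c i) (r i)) = (case i of (x,u,v) \<Rightarrow> v - u)"
          using FK by (cases i) (auto simp: K_def D_def cb)
      qed
      finally show ?thesis using le by simp
    qed
    let ?U = "\<Union>i\<in>C. cball (c i) (r i)"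
    have U: "?U \<in> lmeasurable" "measure lebesgue ?U \<le> e"
    proof -
      have "\<And>i. i \<in> C \<Longrightarrow> cball (c i) (r i) \<in> lmeasurable" by auto
      then show "?U \<in> lmeasurable" "measure lebesgue ?U \<le> e"
        using fmeasurable_UN_bound[OF C(1), of "\<lambda>i. cball (c i) (r i)" lebesgue e]
          measure_UN_bound[OF C(1), of "\<lambda>i. cball (c i) (r i)" lebesgue e] fin by auto
    qed
    let ?N = "B k - ?U"
    have "?N \<in> lmeasurable" "measure lebesgue ?N = 0"
      using C(4) negligible_iff_measure by blast+
    then have "?U \<union> ?N \<in> lmeasurable \<and> measure lebesgue (?U \<union> ?N) \<le> e"
      using U measure_Un_le[of ?U lebesgue ?N] fmeasurable.Un[of ?U lebesgue ?N] fmeasurableD by force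
    then show "\<exists>T. B k \<subseteq> T \<and> T \<in> lmeasurable \<and> measure lebesgue T \<le> e"
      by (intro exI[of _ "?U \<union> ?N"]) auto
  qed
  show thesis
  proof (rule that[of "\<Union>k. B k"])
    show "negligible (\<Union>k. B k)" using neg by (intro negligible_Union_nat) auto
  next
    fix x assume x: "x \<in> {a<..<b} - (\<Union>k. B k)"
    show "((\<lambda>u. integral {a..u} f) has_vector_derivative f x) (at x)"
      unfolding has_vector_derivative_def has_derivative_at_alt
    proof (intro conjI allI impI)
      show "bounded_linear (\<lambda>h. h *\<^sub>R f x)" by (rule bounded_linear_scaleR_left)
      fix e :: real assume e: "e > 0"
      then obtain k where k: "1 / (real k + 1) < e"
        by (metis add.commute inverse_eq_divide of_nat_Suc reals_Archimedean)
      obtain d where d: "d > 0"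
        and nD: "\<And>u v. D x u v \<Longrightarrow> v - u < d \<Longrightarrow> norm ((v - u) *\<^sub>R f x - integral {u..v} f) \<le> (v - u) / (real k + 1)"
      proof -
        from x have "x \<notin> B k" "x \<in> {a<..<b}" by auto
        then obtain d where "d > 0" "\<And>u v. \<not> (D x u v \<and> v - u < d \<and>
            norm ((v - u) *\<^sub>R f x - integral {u..v} f) > (v - u) / (real k + 1))"
          unfolding B_def by blast
        then show thesis using that[of d] by (meson not_less)
      qed
      define d' where "d' = min d (min (x - a) (b - x))"
      have d': "d' > 0" using d x by (auto simp: d'_def)
      show "\<exists>d>0. \<forall>y. norm (y - x) < d \<longrightarrow>
         norm (integral {a..y} f - integral {a..x} f - (y - x) *\<^sub>R f x) \<le> e * norm (y - x)"
      proof (intro exI[of _ d'] conjI allI impI d')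
        fix y assume y: "norm (y - x) < d'"
        have ek: "t / (real k + 1) \<le> e * t" if "t \<ge> 0" for t
          using k mult_right_mono[of "1 / (real k + 1)" e t] that by auto
        consider "y = x" | "x < y" | "y < x" by linarith
        then show "norm (integral {a..y} f - integral {a..x} f - (y - x) *\<^sub>R f x) \<le> e * norm (y - x)"
        proof cases
          case 2
          have "integral {a..x} f + integral {x..y} f = integral {a..y} f"
            using x y 2 by (intro Henstock_Kurzweil_Integration.integral_combine integrable_on_subinterval[OF f])
                (auto simp: d'_def)
          then have "norm (integral {a..y} f - integral {a..x} f - (y - x) *\<^sub>R f x) = norm ((y - x) *\<^sub>R f x - integral {x..y} f)"
            by (metis add_diff_cancel_left' norm_minus_commute)
          also have "\<dots> \<le> (y - x) / (real k + 1)"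
            using x y 2 by (intro nD) (auto simp: D_def d'_def)
          finally show ?thesis using ek[of "y - x"] 2 by simp
        next
          case 3
          have "integral {a..y} f + integral {y..x} f = integral {a..x} f"
            using x y 3 by (intro Henstock_Kurzweil_Integration.integral_combine integrable_on_subinterval[OF f])
                (auto simp: d'_def)
          then have "integral {a..y} f - integral {a..x} f - (y - x) *\<^sub>R f x = (x - y) *\<^sub>R f x - integral {y..x} f"
            by (auto simp: algebra_simps)
          also have "norm \<dots> \<le> (x - y) / (real k + 1)"
            using x y 3 by (intro nD) (auto simp: D_def d'_def)
          finally show ?thesis using ek[of "x - y"] 3 by simp
        qed auto
      qed
    qed
  qed
qed

section \<open>Smooth test functions\<close>

text \<open>Counting derivatives allows closure under products, reciprocals and affine substitution
  to be proved by induction on \<open>n\<close>. The derivative is an existential witness, so it can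
  be given by an explicit formula in each case.\<close>

primrec times_differentiable :: "nat \<Rightarrow> (real \<Rightarrow> real) \<Rightarrow> bool" where
  "times_differentiable 0 f \<longleftrightarrow> True"
| "times_differentiable (Suc n) f \<longleftrightarrow>
     (\<exists>f'. (\<forall>x. (f has_real_derivative f' x) (at x)) \<and> times_differentiable n f')"

definition smooth_real :: "(real \<Rightarrow> real) \<Rightarrow> bool" where
  "smooth_real f \<longleftrightarrow> (\<forall>n. times_differentiable n f)"

lemma times_differentiable_SucD: "times_differentiable (Suc n) f \<Longrightarrow> times_differentiable n f"
  by (induction n arbitrary: f) (simp, metis times_differentiable.simps(2))

lemma times_differentiable_const: "times_differentiable n (\<lambda>x. c)"
  by (induction n arbitrary: c) (auto intro!: exI[of _ "\<lambda>x. 0"])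

lemma times_differentiable_add:
  "times_differentiable n f \<Longrightarrow> times_differentiable n g \<Longrightarrow> times_differentiable n (\<lambda>x. f x + g x)"
proof (induction n arbitrary: f g)
  case (Suc n)
  then obtain f' g' where "\<forall>x. (f has_real_derivative f' x) (at x)" "times_differentiable n f'"
     "\<forall>x. (g has_real_derivative g' x) (at x)" "times_differentiable n g'" by auto
  with Suc.IH[of f' g'] show ?case
    by (auto intro!: exI[of _ "\<lambda>x. f' x + g' x"] DERIV_add)
qed simp

lemma times_differentiable_mult:
  "times_differentiable n f \<Longrightarrow> times_differentiable n g \<Longrightarrow> times_differentiable n (\<lambda>x. f x * g x)"
proof (induction n arbitrary: f g)
  case (Suc n)
  from Suc.prems obtain f' g' where *: "\<forall>x. (f has_real_derivative f' x) (at x)" "times_differentiable n f'"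
     "\<forall>x. (g has_real_derivative g' x) (at x)" "times_differentiable n g'" by auto
  have "times_differentiable n (\<lambda>x. f' x * g x + g' x * f x)"
    using *(2,4) Suc.prems[THEN times_differentiable_SucD] by (intro times_differentiable_add Suc.IH)
  with * show ?case by (auto intro!: exI[of _ "\<lambda>x. f' x * g x + g' x * f x"] DERIV_mult)
qed simp

lemma times_differentiable_inverse:
  "times_differentiable n f \<Longrightarrow> (\<And>x. f x \<noteq> 0) \<Longrightarrow> times_differentiable n (\<lambda>x. inverse (f x))"
proof (induction n arbitrary: f)
  case (Suc n)
  from Suc.prems obtain f' where *: "\<forall>x. (f has_real_derivative f' x) (at x)" "times_differentiable n f'"
    by auto
  have i: "times_differentiable n (\<lambda>x. inverse (f x))"
    using times_differentiable_SucD[OF Suc.prems(1)] Suc.prems(2) by (rule Suc.IH)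
  have "times_differentiable n (\<lambda>x. - 1 * (f' x * (inverse (f x) * inverse (f x))))"
    using * i by (intro times_differentiable_mult times_differentiable_const)
  moreover have "\<forall>x. ((\<lambda>x. inverse (f x)) has_real_derivative (- 1 * (f' x * (inverse (f x) * inverse (f x))))) (at x)"
    using * Suc.prems(2) by (auto intro!: derivative_eq_intros)
  ultimately show ?case by auto
qed simp

lemma times_differentiable_affine:
  "times_differentiable n f \<Longrightarrow> times_differentiable n (\<lambda>x. f (c * x + d))"
proof (induction n arbitrary: f)
  case (Suc n)
  from Suc.prems obtain f' where *: "\<forall>x. (f has_real_derivative f' x) (at x)" "times_differentiable n f'"
    by auto
  have "times_differentiable n (\<lambda>x. f' (c * x + d) * c)"
    using * Suc.IH by (intro times_differentiable_mult times_differentiable_const) auto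
  moreover have "((\<lambda>x. f (c * x + d)) has_real_derivative (f' (c * x + d) * c)) (at x)" for x
  proof (rule DERIV_chain2[of f])
    show "(f has_real_derivative f' (c * x + d)) (at (c * x + d))" using * by blast
    show "((\<lambda>x. c * x + d) has_real_derivative c) (at x)" by (auto intro!: derivative_eq_intros)
  qed
  ultimately show ?case by (auto intro!: exI[of _ "\<lambda>x. f' (c * x + d) * c"])
qed simp

lemma smooth_real_add: "smooth_real f \<Longrightarrow> smooth_real g \<Longrightarrow> smooth_real (\<lambda>x. f x + g x)"
  and smooth_real_mult: "smooth_real f \<Longrightarrow> smooth_real g \<Longrightarrow> smooth_real (\<lambda>x. f x * g x)"
  and smooth_real_inverse: "smooth_real f \<Longrightarrow> (\<And>x. f x \<noteq> 0) \<Longrightarrow> smooth_real (\<lambda>x. inverse (f x))"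
  and smooth_real_affine: "smooth_real f \<Longrightarrow> smooth_real (\<lambda>x. f (c * x + d))"
  and smooth_real_const: "smooth_real (\<lambda>x. d)"
  by (auto simp: smooth_real_def times_differentiable_add times_differentiable_mult
      times_differentiable_inverse times_differentiable_affine times_differentiable_const)

lemma smooth_real_derivative:
  assumes "smooth_real f" and f': "\<And>x. (f has_real_derivative f' x) (at x)"
  shows "smooth_real f'"
  unfolding smooth_real_def
proof
  fix n
  have "times_differentiable (Suc n) f" using assms by (simp add: smooth_real_def)
  then obtain g where g: "\<forall>x. (f has_real_derivative g x) (at x)" "times_differentiable n g" by auto
  then have "g = f'" using f' DERIV_unique by blast
  with g show "times_differentiable n f'" by simp
qed

lemma smooth_real_obtain_derivative:
  assumes "smooth_real f"
  obtains f' where "\<And>x. (f has_real_derivative f' x) (at x)" "smooth_real f'"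
proof -
  have "times_differentiable (Suc 0) f" using assms smooth_real_def by blast
  then obtain f' where "\<And>x. (f has_real_derivative f' x) (at x)" by auto
  then show thesis using that smooth_real_derivative[OF assms] by blast
qed

lemma smooth_real_continuous: "smooth_real f \<Longrightarrow> continuous_on A f"
  by (metis smooth_real_obtain_derivative DERIV_continuous_on has_field_derivative_at_within)

text \<open>The polynomial factor makes this family closed under differentiation, so one derivative
  formula yields smoothness of all orders. The case \<open>p = 1\<close> is the classical function
  exp(-1/x), flat at 0.\<close>

definition exp_recip :: "real poly \<Rightarrow> real \<Rightarrow> real" where
  "exp_recip p x = (if x > 0 then poly p (1/x) * exp (- (1/x)) else 0)"

lemma poly_div_exp_tendsto_0: "((\<lambda>y. poly p y * exp (- y)) \<longlongrightarrow> (0::real)) at_top"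
proof -
  have "((\<lambda>y::real. \<Sum>i\<le>degree p. coeff p i * (y ^ i / exp y)) \<longlongrightarrow> (\<Sum>i\<le>degree p. coeff p i * 0)) at_top"
    by (intro tendsto_sum tendsto_mult tendsto_const tendsto_power_div_exp_0)
  moreover have "(\<Sum>i\<le>degree p. coeff p i * (y ^ i / exp y)) = poly p y * exp (- y)" for y :: real
    by (simp add: poly_altdef sum_distrib_right exp_minus divide_inverse mult.assoc)
  ultimately show ?thesis by simp
qed

text \<open>With y = 1/x, the derivative of p(y) exp(-y) in x is y^2 (p(y) - p'(y)) exp(-y), because
  dy/dx = -y^2. The factor \<open>[:0,0,1:]\<close> is y^2.\<close>

lemma exp_recip_has_derivative:
  "(exp_recip p has_real_derivative exp_recip ([:0,0,1:] * (p - pderiv p)) x) (at x)"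
proof -
  consider "x > 0" | "x < 0" | "x = 0" by linarith
  then show ?thesis
  proof cases
    case 1
    have "((\<lambda>x. poly p (1/x) * exp (- (1/x))) has_real_derivative
        (poly ([:0,0,1:] * (p - pderiv p)) (1/x) * exp (- (1/x)))) (at x)"
      using 1 by (auto intro!: derivative_eq_intros DERIV_chain2[OF poly_DERIV] simp: field_simps power2_eq_square)
    then have "(exp_recip p has_real_derivative (poly ([:0,0,1:] * (p - pderiv p)) (1/x) * exp (- (1/x)))) (at x)"
      by (rule has_field_derivative_transform_within_open[of _ _ _ "{0<..}"]) (use 1 in \<open>auto simp: exp_recip_def\<close>)
    with 1 show ?thesis by (simp add: exp_recip_def)
  next
    case 2
    have "((\<lambda>x::real. 0) has_real_derivative 0) (at x)" by simp
    then have "(exp_recip p has_real_derivative 0) (at x)"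
      by (rule has_field_derivative_transform_within_open[of _ _ _ "{..<0}"]) (use 2 in \<open>auto simp: exp_recip_def\<close>)
    with 2 show ?thesis by (simp add: exp_recip_def)
  next
    case 3
    \<comment> \<open>The difference quotient at 0 divides by \<open>h\<close>, which is one more
      factor y = 1/h; this is the factor \<open>[:0,1:]\<close>.\<close>
    have "((\<lambda>y. poly ([:0,1:] * p) y * exp (- y)) \<longlongrightarrow> 0) at_top"
      by (rule poly_div_exp_tendsto_0)
    then have "((\<lambda>h. poly ([:0,1:] * p) (inverse h) * exp (- (inverse h))) \<longlongrightarrow> 0) (at_right (0::real))"
      by (rule filterlim_compose[OF _ filterlim_inverse_at_top_right])
    then have R: "((\<lambda>h. (exp_recip p (0 + h) - exp_recip p 0) / h) \<longlongrightarrow> 0) (at_right 0)"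
      by (rule Lim_transform_eventually)
         (auto simp: exp_recip_def eventually_at_filter field_simps)
    have L: "((\<lambda>h. (exp_recip p (0 + h) - exp_recip p 0) / h) \<longlongrightarrow> 0) (at_left 0)"
      by (rule Lim_transform_eventually[OF tendsto_const])
         (auto simp: exp_recip_def eventually_at_filter)
    show ?thesis unfolding 3
      using filterlim_split_at[OF L R] by (simp add: DERIV_def) (simp add: exp_recip_def)
  qed
qed

lemma smooth_exp_recip: "smooth_real (exp_recip p)"
proof -
  have "times_differentiable n (exp_recip p)" for n
    by (induction n arbitrary: p) (auto intro: exp_recip_has_derivative)
  then show ?thesis by (simp add: smooth_real_def)
qed

text \<open>The quotient of \<psi>(x) by \<psi>(x) + \<psi>(1-x), where \<psi>(x) is exp(-1/x) for
  positive x and 0 otherwise. The denominator never vanishes, since x or 1-x is positive. The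
  derivative \<open>S'\<close> serves later as a smoothing kernel, which is why its sign
  matters.\<close>

lemma smooth_step_exists:
  obtains S S' :: "real \<Rightarrow> real" where "smooth_real S" "\<And>x. (S has_real_derivative S' x) (at x)"
    "\<And>x. S' x \<ge> 0" "\<And>x. x \<le> 0 \<Longrightarrow> S x = 0" "\<And>x. x \<ge> 1 \<Longrightarrow> S x = 1" "mono S"
proof -
  define \<psi> where "\<psi> = exp_recip 1"
  have sm: "smooth_real \<psi>" unfolding \<psi>_def by (rule smooth_exp_recip)
  have \<psi>0: "\<psi> x \<ge> 0" and \<psi>p: "x > 0 \<Longrightarrow> \<psi> x > 0" and \<psi>z: "x \<le> 0 \<Longrightarrow> \<psi> x = 0" for x
    by (auto simp: \<psi>_def exp_recip_def)
  have mono: "\<psi> x \<le> \<psi> y" if "x \<le> y" for x y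
    using that by (auto simp: \<psi>_def exp_recip_def frac_le)
  have pos: "\<psi> x + \<psi> (- 1 * x + 1) > 0" for x
    using \<psi>0[of x] \<psi>0[of "1 - x"] \<psi>p[of x] \<psi>p[of "1 - x"] by (cases "x > 0") (auto intro: add_pos_nonneg add_nonneg_pos)
  define S where "S x = \<psi> x * inverse (\<psi> x + \<psi> (- 1 * x + 1))" for x
  have S: "smooth_real S"
    unfolding S_def using pos
    by (intro smooth_real_mult smooth_real_inverse smooth_real_add smooth_real_affine sm) (metis less_irrefl)
  obtain S' where S': "\<And>x. (S has_real_derivative S' x) (at x)"
    using smooth_real_obtain_derivative[OF S] by blast
  have m: "mono S"
  proof
    fix x y :: real assume xy: "x \<le> y"
    \<comment> \<open>Monotonicity of the quotient after cross-multiplication: the common product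
      \<psi>(x)\<psi>(y) cancels, and the remaining factors compare by monotonicity of
      \<psi>.\<close>
    have "\<psi> x * \<psi> (- 1 * y + 1) \<le> \<psi> y * \<psi> (- 1 * x + 1)"
      using xy \<psi>0 by (intro mult_mono mono) auto
    then have "\<psi> x * (\<psi> y + \<psi> (- 1 * y + 1)) \<le> \<psi> y * (\<psi> x + \<psi> (- 1 * x + 1))"
      by (simp add: algebra_simps)
    then show "S x \<le> S y"
      unfolding S_def divide_inverse[symmetric] using pos[of x] pos[of y]
      by (subst frac_le_eq) (auto simp: divide_nonpos_pos mult.commute)
  qed
  have "S' x \<ge> 0" for x
  proof (rule ccontr)
    assume "\<not> S' x \<ge> 0"
    then obtain d where "d > 0" "\<forall>h>0. h < d \<longrightarrow> S (x + h) < S x"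
      using DERIV_neg_dec_right[OF S'] by (metis not_le)
    then have "S (x + d/2) < S x" by auto
    then show False using monoD[OF m, of x "x + d/2"] \<open>d > 0\<close> by auto
  qed
  moreover have "S x = 1" if "x \<ge> 1" for x
    using that pos[of x] by (simp add: S_def \<psi>z)
  ultimately show thesis
    using S S' m by (intro that[of S S']) (auto simp: S_def \<psi>z)
qed

lemma tensor_has_derivative:
  assumes "\<And>x. (A has_real_derivative A' x) (at x)" "\<And>x. (B has_real_derivative B' x) (at x)"
  shows "((\<lambda>z. A (Re z) * B (Im z)) has_derivative
     (\<lambda>v. Re v * (A' (Re z) * B (Im z)) + Im v * (A (Re z) * B' (Im z)))) (at z)"
proof -
  have a: "((\<lambda>z. A (Re z)) has_derivative (\<lambda>v. Re v * A' (Re z))) (at z)"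
    using has_derivative_compose[OF bounded_linear_imp_has_derivative[OF bounded_linear_Re], of A "\<lambda>v. v * A' (Re z)" z UNIV]
      assms(1) by (auto simp: has_field_derivative_def mult_commute_abs)
  have b: "((\<lambda>z. B (Im z)) has_derivative (\<lambda>v. Im v * B' (Im z))) (at z)"
    using has_derivative_compose[OF bounded_linear_imp_has_derivative[OF bounded_linear_Im], of B "\<lambda>v. v * B' (Im z)" z UNIV]
      assms(2) by (auto simp: has_field_derivative_def mult_commute_abs)
  show ?thesis
    by (rule has_derivative_eq_rhs[OF has_derivative_mult[OF a b]]) (auto simp: algebra_simps)
qed

lemma frechet_derivative_tensor:
  assumes "\<And>x. (A has_real_derivative A' x) (at x)" "\<And>x. (B has_real_derivative B' x) (at x)"
  shows "frechet_derivative (\<lambda>z. A (Re z) * B (Im z)) (at z) 1 = A' (Re z) * B (Im z)"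
    "frechet_derivative (\<lambda>z. A (Re z) * B (Im z)) (at z) \<i> = A (Re z) * B' (Im z)"
  unfolding frechet_derivative_at[OF tensor_has_derivative[OF assms], symmetric] by auto

text \<open>The two partial derivatives of a product of this kind are again such products, with
  \<open>A'\<close> in place of \<open>A\<close> or \<open>B'\<close> in place of \<open>B\<close>.
  The class is thus closed under the rule of \<open>smooth_fun\<close>, which is what coinduction
  asks for.\<close>

lemma smooth_fun_tensor:
  assumes "smooth_real A" "smooth_real B"
  shows "smooth_fun (\<lambda>z. A (Re z) * B (Im z))"
  using assms
proof (coinduction arbitrary: A B)
  case (smooth_fun A B)
  obtain A' where A': "\<And>x. (A has_real_derivative A' x) (at x)" "smooth_real A'"
    using smooth_real_obtain_derivative[OF smooth_fun(1)] by blast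
  obtain B' where B': "\<And>x. (B has_real_derivative B' x) (at x)" "smooth_real B'"
    using smooth_real_obtain_derivative[OF smooth_fun(2)] by blast
  have "\<forall>z. (\<lambda>z. A (Re z) * B (Im z)) differentiable at z"
    using tensor_has_derivative[OF A'(1) B'(1)] unfolding differentiable_def by blast
  then show ?case
    using smooth_fun A' B' by (auto simp: frechet_derivative_tensor[OF A'(1) B'(1)])
qed

section \<open>From weak derivatives to integrals over rectangles\<close>

text \<open>An approximate identity: the rescaled kernels keep mass 1. Substituting \<tau> = c x + d
  moves the scaling into the argument of \<open>F\<close>, and dominated convergence applies with
  majorant \<open>M * K\<close>. The limit is assumed only for \<tau> in [0,1], where the kernel
  lives, so that one-sided limits of \<open>F\<close> will do.\<close>

lemma lborel_kernel_limit:
  fixes F :: "real \<Rightarrow> 'b::euclidean_space" and c d :: "nat \<Rightarrow> real"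
  assumes K: "has_bochner_integral lborel K 1" "\<And>x. K x \<ge> 0" "\<And>x. x \<notin> {0..1} \<Longrightarrow> K x = 0"
    and c: "\<And>k. c k > 0"
    and F: "F \<in> borel_measurable borel" "\<And>x. norm (F x) \<le> M"
    and lim: "\<And>\<tau>. \<tau> \<in> {0..1} \<Longrightarrow> (\<lambda>k. F ((\<tau> - d k) / c k)) \<longlonglongrightarrow> L"
  shows "(\<lambda>k. \<integral>x. (c k * K (c k * x + d k)) *\<^sub>R F x \<partial>lborel) \<longlonglongrightarrow> L"
    and "norm (\<integral>x. (c k * K (c k * x + d k)) *\<^sub>R F x \<partial>lborel) \<le> M"
    and "integrable lborel (\<lambda>x. (c k * K (c k * x + d k)) *\<^sub>R F x)"
proof -
  note [measurable] = F(1)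
  have Kint: "integrable lborel K" "integral\<^sup>L lborel K = 1"
    using K(1) by (auto simp: has_bochner_integral_iff)
  have [measurable]: "K \<in> borel_measurable borel"
    using Kint(1) by (auto dest: borel_measurable_integrable)
  have M: "M \<ge> 0" using F(2)[of 0] norm_ge_zero order_trans by blast
  have sub: "(\<integral>x. (c k * K (c k * x + d k)) *\<^sub>R F x \<partial>lborel) = (\<integral>\<tau>. K \<tau> *\<^sub>R F ((\<tau> - d k) / c k) \<partial>lborel)" for k
  proof -
    have "(\<integral>x. (c k * K (c k * x + d k)) *\<^sub>R F x \<partial>lborel) =
       \<bar>1 / c k\<bar> *\<^sub>R (\<integral>x. (c k * K (c k * (- d k / c k + (1 / c k) * x) + d k)) *\<^sub>R F (- d k / c k + (1 / c k) * x) \<partial>lborel)"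
      using c[of k] by (intro lborel_integral_real_affine) auto
    also have "\<dots> = (\<integral>\<tau>. K \<tau> *\<^sub>R F ((\<tau> - d k) / c k) \<partial>lborel)"
    proof -
      have "c k * (- d k / c k + (1 / c k) * x) + d k = x" "- d k / c k + (1 / c k) * x = (x - d k) / c k" for x
        using c[of k] by (auto simp: field_simps)
      then show ?thesis using c[of k] by (simp flip: integral_scaleR_right)
    qed
    finally show ?thesis .
  qed
  have bd: "norm (K \<tau> *\<^sub>R F ((\<tau> - d k) / c k)) \<le> M * K \<tau>" for \<tau> k
    using mult_right_mono[OF F(2) K(2)[of \<tau>], of "(\<tau> - d k) / c k"] K(2)[of \<tau>] by (simp add: mult.commute)
  have i: "integrable lborel (\<lambda>\<tau>. K \<tau> *\<^sub>R F ((\<tau> - d k) / c k))" for k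
    by (rule Bochner_Integration.integrable_bound[OF integrable_mult_right[OF Kint(1), of M]])
       (use bd M K(2) in \<open>auto\<close>)
  have "(\<lambda>k. \<integral>\<tau>. K \<tau> *\<^sub>R F ((\<tau> - d k) / c k) \<partial>lborel) \<longlonglongrightarrow> (\<integral>\<tau>. K \<tau> *\<^sub>R L \<partial>lborel)"
  proof (rule integral_dominated_convergence[where w = "\<lambda>\<tau>. M * K \<tau>"])
    show "AE x in lborel. (\<lambda>i. K x *\<^sub>R F ((x - d i) / c i)) \<longlonglongrightarrow> K x *\<^sub>R L"
    proof (rule AE_I2)
      fix x show "(\<lambda>i. K x *\<^sub>R F ((x - d i) / c i)) \<longlonglongrightarrow> K x *\<^sub>R L"
        using lim[of x] K(3)[of x] by (cases "x \<in> {0..1}") (auto intro: tendsto_scaleR)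
    qed
  qed (use Kint bd in auto)
  then show "(\<lambda>k. \<integral>x. (c k * K (c k * x + d k)) *\<^sub>R F x \<partial>lborel) \<longlonglongrightarrow> L"
    unfolding sub using Kint by simp
  have "norm (\<integral>\<tau>. K \<tau> *\<^sub>R F ((\<tau> - d k) / c k) \<partial>lborel) \<le> (\<integral>\<tau>. M * K \<tau> \<partial>lborel)"
    using Kint bd by (intro Bochner_Integration.integral_norm_bound_integral i) auto
  then show "norm (\<integral>x. (c k * K (c k * x + d k)) *\<^sub>R F x \<partial>lborel) \<le> M"
    unfolding sub using Kint by simp
  have "integrable lborel (\<lambda>x. c k *\<^sub>R (K (c k * x + d k) *\<^sub>R F x))"
  proof (rule integrable_scaleR_right)
    have "integrable lborel (\<lambda>x. K (d k + c k * x) *\<^sub>R F ((d k + c k * x - d k) / c k))"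
      using lborel_integrable_real_affine[OF i[of k], of "c k" "d k"] c[of k] by simp
    then show "integrable lborel (\<lambda>x. K (c k * x + d k) *\<^sub>R F x)"
      using c[of k] by (simp add: add.commute)
  qed
  then show "integrable lborel (\<lambda>x. (c k * K (c k * x + d k)) *\<^sub>R F x)" by simp
qed

lemma lborel_integral_fst:
  fixes f :: "'a::euclidean_space \<times> 'b::euclidean_space \<Rightarrow> 'c::{banach, second_countable_topology}"
  assumes "integrable lborel f"
  shows "(\<integral>x. \<integral>y. f (x, y) \<partial>lborel \<partial>lborel) = integral\<^sup>L lborel f"
    "integrable lborel (\<lambda>x. \<integral>y. f (x, y) \<partial>lborel)"
    "AE x in lborel. integrable lborel (\<lambda>y. f (x, y))"
  using lborel_pair.integral_fst'[of f] lborel_pair.integrable_fst'[of f] lborel_pair.AE_integrable_fst'[of f] assms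
  by (simp_all add: lborel_prod)

text \<open>A difference of two steps: \<open>A\<close> rises on [a, a + 1/c] and falls on
  [b - 1/c, b]. The condition \<open>c * (b - a) \<ge> 1\<close> lets the rising step stay ahead of
  the falling one, so that \<open>A\<close> is nonnegative. Its derivative is a difference of two
  rescaled kernels.\<close>

lemma smooth_plateau:
  fixes S S' :: "real \<Rightarrow> real"
  assumes S: "smooth_real S" "\<And>x. (S has_real_derivative S' x) (at x)"
     "\<And>x. x \<le> 0 \<Longrightarrow> S x = 0" "\<And>x. x \<ge> 1 \<Longrightarrow> S x = 1" "mono S"
    and c: "c > 0" "c * (b - a) \<ge> 1"
  defines "A \<equiv> \<lambda>x. S (c * x + (- c * a)) - S (c * x + (1 - c * b))"
    and "A' \<equiv> \<lambda>x. c * S' (c * x + (- c * a)) - c * S' (c * x + (1 - c * b))"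
  shows "smooth_real A" "(A has_real_derivative A' x) (at x)" "0 \<le> A x" "A x \<le> 1" "x \<notin> {a..b} \<Longrightarrow> A x = 0"
proof -
  have "smooth_real (\<lambda>x. S (c * x + (- c * a)) + (- 1) * S (c * x + (1 - c * b)))"
    by (intro smooth_real_add smooth_real_mult smooth_real_const smooth_real_affine S)
  then show "smooth_real A" by (simp add: A_def)
  show "(A has_real_derivative A' x) (at x)"
    unfolding A_def A'_def
  proof (rule DERIV_diff)
    have "((\<lambda>x. c * x + d) has_real_derivative c) (at x)" for d
      by (auto intro!: derivative_eq_intros)
    from DERIV_chain2[OF S(2) this]
    have *: "((\<lambda>x. S (c * x + d)) has_real_derivative c * S' (c * x + d)) (at x)" for d
      by (simp add: mult.commute)
    show "((\<lambda>x. S (c * x + (- c * a))) has_real_derivative c * S' (c * x + (- c * a))) (at x)"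
      "((\<lambda>x. S (c * x + (1 - c * b))) has_real_derivative c * S' (c * x + (1 - c * b))) (at x)"
      by (rule *)+
  qed
  have 01: "0 \<le> S y" "S y \<le> 1" for y
    using monoD[OF S(5), of "min y 0" y] monoD[OF S(5), of y "max y 1"] S(3)[of "min y 0"] S(4)[of "max y 1"]
    by auto
  have le: "c * x + (1 - c * b) \<le> c * x + (- c * a)" using c by (simp add: algebra_simps)
  show "0 \<le> A x" unfolding A_def using monoD[OF S(5) le] by simp
  show "A x \<le> 1" unfolding A_def using 01[of "c * x + (- c * a)"] 01[of "c * x + (1 - c * b)"] by simp
  assume "x \<notin> {a..b}"
  then consider "x < a" | "x > b" by force
  then show "A x = 0"
  proof cases
    case 1
    then have "c * x + (- c * a) \<le> 0" using c by simp
    then show ?thesis using le by (simp add: A_def S(3))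
  next
    case 2
    then have "c * x + (1 - c * b) \<ge> 1" using c by simp
    then show ?thesis using le by (simp add: A_def S(4))
  qed
qed

text \<open>The weak identity is tested with products of plateaus that tend to the indicator of the
  open rectangle. On the right this gives the integral of \<open>G\<close>; on the left
  \<open>A'\<close> concentrates at \<open>t1\<close> and \<open>t2\<close> and picks out the
  boundary values of \<open>H\<close> there.\<close>

lemma rectangle_identity:
  fixes H G :: "real \<times> real \<Rightarrow> 'b::euclidean_space"
  assumes st: "s1 < s2" "t1 < t2"
    and H: "continuous_on ({s1..s2} \<times> {t1..t2}) H"
    and G: "integrable lborel G"
    and wk: "\<And>A A' B. \<lbrakk>smooth_real A; \<And>x. (A has_real_derivative A' x) (at x); smooth_real B;
        \<And>t. t \<notin> {t1..t2} \<Longrightarrow> A t = 0; \<And>s. s \<notin> {s1..s2} \<Longrightarrow> B s = 0\<rbrakk> \<Longrightarrow>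
        (\<integral>p. (B (fst p) * A' (snd p)) *\<^sub>R indicator ({s1..s2} \<times> {t1..t2}) p *\<^sub>R H p \<partial>lborel) =
        - (\<integral>p. (B (fst p) * A (snd p)) *\<^sub>R G p \<partial>lborel)"
  shows "(LBINT s:{s1<..<s2}. H (s, t2) - H (s, t1)) = (LBINT p:{s1<..<s2} \<times> {t1<..<t2}. G p)"
proof -
  obtain S S' :: "real \<Rightarrow> real" where S: "smooth_real S" "\<And>x. (S has_real_derivative S' x) (at x)"
    "\<And>x. x \<le> 0 \<Longrightarrow> S x = 0" "\<And>x. x \<ge> 1 \<Longrightarrow> S x = 1" "mono S" and S'0: "\<And>x. S' x \<ge> 0"
    using smooth_step_exists by metis
  note sS' = smooth_real_derivative[OF S(1,2)]
  have S'm[measurable]: "S' \<in> borel_measurable borel"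
    by (intro borel_measurable_continuous_onI smooth_real_continuous sS')
  have S'z: "S' x = 0" if "x \<notin> {0..1}" for x
  proof -
    have "(S has_real_derivative 0) (at x)"
    proof (cases "x < 0")
      case True
      show ?thesis
        by (rule has_field_derivative_transform_within_open[of "\<lambda>x. 0" _ _ "{..<0}"]) (use True S(3) in auto)
    next
      case False
      show ?thesis
        by (rule has_field_derivative_transform_within_open[of "\<lambda>x. 1" _ _ "{1<..}"]) (use False that S(4) in auto)
    qed
    then show ?thesis using S(2) DERIV_unique by blast
  qed
  have K: "has_bochner_integral lborel S' 1"
  proof -
    have "has_bochner_integral lborel (\<lambda>x. S' x * indicator {0..1} x) (S 1 - S 0)"
      using S(2) S'0 by (intro has_bochner_integral_FTC_Icc_nonneg) auto
    moreover have "(\<lambda>x. S' x * indicator {0..1} x) = S'"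
      using S'z by (auto simp: fun_eq_iff indicator_def)
    ultimately show ?thesis using S by simp
  qed
  define R where "R = {s1..s2} \<times> {t1..t2}"
  have R: "compact R" "R \<in> sets borel" by (auto simp: R_def compact_Times borel_closed closed_Times)
  \<comment> \<open>Extending \<open>H\<close> by zero gives a bounded Borel function on the whole
    plane, as the kernel limit and Fubini require. The jump at the edge does no harm, since the
    kernels sample only from inside.\<close>
  define HH where "HH p = indicator R p *\<^sub>R H p" for p
  have HHm[measurable]: "HH \<in> borel_measurable borel"
    unfolding HH_def using R H by (intro borel_measurable_continuous_on_indicator) (auto simp: R_def)
  obtain M where M: "\<And>p. norm (HH p) \<le> M" "M \<ge> 0"
  proof -
    have "compact (H ` R)" using H R by (auto simp: R_def intro: compact_continuous_image)
    then obtain M where "\<forall>y\<in>H ` R. norm y \<le> M" using bounded_iff compact_imp_bounded by blast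
    then have "norm (HH p) \<le> max M 0" for p
      by (cases "p \<in> R") (auto simp: HH_def le_max_iff_disj)
    then show thesis by (intro that[of "max M 0"]) auto
  qed
  \<comment> \<open>The summand \<open>real k\<close> forces divergence; the two reciprocals make
    the plateau condition hold in both variables already from \<open>k = 0\<close>.\<close>
  define c where "c k = real k + 1 + 1 / (t2 - t1) + 1 / (s2 - s1)" for k :: nat
  have c: "c k > 0" "c k \<ge> real k" "c k \<ge> 1 / (t2 - t1)" "c k \<ge> 1 / (s2 - s1)" for k
  proof -
    have "1 / (t2 - t1) > 0" "1 / (s2 - s1) > 0" using st by auto
    then show "c k > 0" "c k \<ge> real k" "c k \<ge> 1 / (t2 - t1)" "c k \<ge> 1 / (s2 - s1)"
      unfolding c_def by linarith+
  qed
  have c1: "c k * (t2 - t1) \<ge> 1" "c k * (s2 - s1) \<ge> 1" for k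
    using c(3,4)[of k] st by (auto simp: pos_divide_le_eq)
  have ctop: "filterlim c at_top sequentially"
    by (rule filterlim_at_top_mono[OF filterlim_real_sequentially]) (use c(2) in auto)
  have clim: "(\<lambda>k. y / c k) \<longlonglongrightarrow> 0" for y
    by (rule real_tendsto_divide_at_top[OF tendsto_const ctop])
  define A where "A k = (\<lambda>x. S (c k * x + (- c k * t1)) - S (c k * x + (1 - c k * t2)))" for k
  define A' where "A' k = (\<lambda>x. c k * S' (c k * x + (- c k * t1)) - c k * S' (c k * x + (1 - c k * t2)))" for k
  define B where "B k = (\<lambda>x. S (c k * x + (- c k * s1)) - S (c k * x + (1 - c k * s2)))" for k
  have Ap: "smooth_real (A k)" "(A k has_real_derivative A' k x) (at x)" "0 \<le> A k x" "A k x \<le> 1"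
      "x \<notin> {t1..t2} \<Longrightarrow> A k x = 0" for k x
    unfolding A_def A'_def by (rule smooth_plateau[OF S c(1) c1(1)]; assumption?)+
  have Bp: "smooth_real (B k)" "0 \<le> B k x" "B k x \<le> 1" "x \<notin> {s1..s2} \<Longrightarrow> B k x = 0" for k x
    unfolding B_def by (rule smooth_plateau[OF S c(1) c1(2)]; assumption?)+
  have [measurable]: "A k \<in> borel_measurable borel" "B k \<in> borel_measurable borel" for k
    by (auto intro!: borel_measurable_continuous_onI smooth_real_continuous Ap Bp)
  have [measurable]: "A' k \<in> borel_measurable borel" for k
    unfolding A'_def by simp
  have plim: "(\<lambda>k. S (c k * x + (- c k * a)) - S (c k * x + (1 - c k * b))) \<longlonglongrightarrow> indicator {a<..<b} x"
    if "a < b" "\<And>k. c k * (b - a) \<ge> 1" for a b x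
  proof (cases "x \<in> {a<..<b}")
    case False
    then consider "x \<le> a" | "x \<ge> b" by force
    then have "S (c k * x + (- c k * a)) - S (c k * x + (1 - c k * b)) = 0" for k
    proof cases
      case 1
      then have "c k * x + (- c k * a) \<le> 0" using c(1)[of k] by simp
      then show ?thesis using that(2)[of k] by (simp add: S(3) algebra_simps)
    next
      case 2
      then have "c k * x + (1 - c k * b) \<ge> 1" using c(1)[of k] by simp
      then show ?thesis using that(2)[of k] by (simp add: S(4) algebra_simps)
    qed
    then show ?thesis using False by simp
  next
    case True
    have "\<forall>\<^sub>F k in sequentially. c k \<ge> max (1 / (x - a)) (1 / (b - x))"
      using ctop unfolding filterlim_at_top by blast
    then have "\<forall>\<^sub>F k in sequentially. S (c k * x + (- c k * a)) - S (c k * x + (1 - c k * b)) = 1"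
    proof eventually_elim
      case (elim k)
      then have "c k * (x - a) \<ge> 1" "c k * (b - x) \<ge> 1"
        using True by (auto simp: pos_divide_le_eq)
      then show ?case by (simp add: S(3,4) algebra_simps)
    qed
    then show ?thesis using True by (simp add: tendsto_eventually)
  qed
  have Alim: "(\<lambda>k. A k x) \<longlonglongrightarrow> indicator {t1<..<t2} x" for x
    unfolding A_def by (rule plim[OF st(2) c1(1)])
  have Blim: "(\<lambda>k. B k x) \<longlonglongrightarrow> indicator {s1<..<s2} x" for x
    unfolding B_def by (rule plim[OF st(1) c1(2)])
  have G'[measurable]: "G \<in> borel_measurable borel" using G by (auto dest: borel_measurable_integrable)
  have rhs: "(\<lambda>k. \<integral>p. (B k (fst p) * A k (snd p)) *\<^sub>R G p \<partial>lborel) \<longlonglongrightarrow>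
      (\<integral>p. indicator ({s1<..<s2} \<times> {t1<..<t2}) p *\<^sub>R G p \<partial>lborel)"
  proof (rule integral_dominated_convergence[where w = "\<lambda>p. norm (G p)"])
    show "AE p in lborel. (\<lambda>k. (B k (fst p) * A k (snd p)) *\<^sub>R G p) \<longlonglongrightarrow> indicator ({s1<..<s2} \<times> {t1<..<t2}) p *\<^sub>R G p"
    proof (rule AE_I2)
      fix p :: "real \<times> real"
      have "(\<lambda>k. (B k (fst p) * A k (snd p)) *\<^sub>R G p) \<longlonglongrightarrow> (indicator {s1<..<s2} (fst p) * indicator {t1<..<t2} (snd p)) *\<^sub>R G p"
        by (intro tendsto_intros Alim Blim)
      then show "(\<lambda>k. (B k (fst p) * A k (snd p)) *\<^sub>R G p) \<longlonglongrightarrow> indicator ({s1<..<s2} \<times> {t1<..<t2}) p *\<^sub>R G p"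
        by (cases p) (simp add: indicator_times)
    qed
    show "AE p in lborel. norm ((B k (fst p) * A k (snd p)) *\<^sub>R G p) \<le> norm (G p)" for k
    proof (rule AE_I2)
      fix p
      have "\<bar>B k (fst p) * A k (snd p)\<bar> \<le> 1"
        using Ap(3,4)[of k "snd p"] Bp(2,3)[of k "fst p"] by (simp add: abs_mult mult_le_one)
      then show "norm ((B k (fst p) * A k (snd p)) *\<^sub>R G p) \<le> norm (G p)"
        by (simp add: mult_left_le_one_le)
    qed
    show "integrable lborel (\<lambda>p. norm (G p))" using G by simp
    have fsm: "(fst :: real \<times> real \<Rightarrow> real) \<in> borel_measurable borel" "(snd :: real \<times> real \<Rightarrow> real) \<in> borel_measurable borel"
      by (auto intro!: borel_measurable_continuous_onI continuous_intros)
    have "(\<lambda>p::real\<times>real. B k (fst p)) \<in> borel_measurable borel" "(\<lambda>p::real\<times>real. A k (snd p)) \<in> borel_measurable borel" for k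
      by (rule measurable_compose[OF fsm(1)] measurable_compose[OF fsm(2)]; measurable)+
    then show "(\<lambda>p. (B k (fst p) * A k (snd p)) *\<^sub>R G p) \<in> borel_measurable lborel" for k
      using G' by simp
    have "{s1<..<s2} \<times> {t1<..<t2} \<in> sets borel" by (intro borel_open open_Times) auto
    then show "(\<lambda>p. indicator ({s1<..<s2} \<times> {t1<..<t2}) p *\<^sub>R G p) \<in> borel_measurable lborel"
      using G' by simp
  qed
  \<comment> \<open>The inner integral along a line. The rising ramp contributes the value at
    \<open>t1\<close> with a plus sign, the falling one the value at \<open>t2\<close> with a minus
    sign; this reversed difference is turned around at the very end.\<close>
  define J where "J k s = (\<integral>t. A' k t *\<^sub>R HH (s, t) \<partial>lborel)" for k s
  have Jm[measurable]: "J k \<in> borel_measurable borel" for k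
  proof -
    have "(\<lambda>(s,t). A' k t *\<^sub>R HH (s, t)) \<in> borel_measurable (borel \<Otimes>\<^sub>M lborel)" by measurable
    then have "(\<lambda>s. \<integral>t. A' k t *\<^sub>R HH (s, t) \<partial>lborel) \<in> borel_measurable borel"
      by (rule lborel.borel_measurable_lebesgue_integral)
    then show ?thesis unfolding J_def .
  qed
  have Jb: "norm (J k s) \<le> 2 * M"
    and Jlim: "s \<in> {s1..s2} \<Longrightarrow> (\<lambda>k. J k s) \<longlonglongrightarrow> H (s, t1) - H (s, t2)" for s k
  proof -
    have Fm: "(\<lambda>t. HH (s, t)) \<in> borel_measurable borel" by measurable
    note kl = lborel_kernel_limit[OF K S'0 S'z c(1) Fm M(1)]
    have *: "(\<lambda>k. HH (s, a + (\<tau> - \<rho>) / c k)) \<longlonglongrightarrow> HH (s, a)"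
      if a: "a \<in> {t1..t2}" and "\<And>k. a + (\<tau> - \<rho>) / c k \<in> {t1..t2}" for a \<tau> \<rho>
    proof (cases "s \<in> {s1..s2}")
      case True
      have "(\<lambda>k. H (s, a + (\<tau> - \<rho>) / c k)) \<longlonglongrightarrow> H (s, a)"
      proof (rule continuous_on_tendsto_compose[OF H])
        show "(\<lambda>k. (s, a + (\<tau> - \<rho>) / c k)) \<longlonglongrightarrow> (s, a)"
          using tendsto_add[OF tendsto_const clim[of "\<tau> - \<rho>"], of a] by (intro tendsto_Pair tendsto_const) simp
      qed (use that True in auto)
      then show ?thesis using that True by (simp add: HH_def R_def)
    qed (auto simp: HH_def R_def indicator_def)
    \<comment> \<open>The sampling points are \<open>t1 + \<tau> / c k\<close>, to the right of
      \<open>t1\<close>; in \<open>l2\<close> they are \<open>t2 + (\<tau> - 1) / c k\<close>, to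
      the left of \<open>t2\<close>. Both stay in the closed interval, where \<open>H\<close> is
      continuous.\<close>
    have l1: "(\<lambda>k. HH (s, (\<tau> - (- c k * t1)) / c k)) \<longlonglongrightarrow> HH (s, t1)" if \<tau>: "\<tau> \<in> {0..1}" for \<tau>
    proof -
      have e: "(\<tau> - (- c k * t1)) / c k = t1 + (\<tau> - 0) / c k" for k using c(1)[of k] by (simp add: field_simps)
      have "t1 + (\<tau> - 0) / c k \<in> {t1..t2}" for k
      proof -
        have "\<tau> \<le> c k * (t2 - t1)" using \<tau> c1(1)[of k] by auto
        then show ?thesis using \<tau> c(1)[of k] by (auto simp: field_simps)
      qed
      then show ?thesis unfolding e using st by (intro *) auto
    qed
    have l2: "(\<lambda>k. HH (s, (\<tau> - (1 - c k * t2)) / c k)) \<longlonglongrightarrow> HH (s, t2)" if \<tau>: "\<tau> \<in> {0..1}" for \<tau>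
    proof -
      have e: "(\<tau> - (1 - c k * t2)) / c k = t2 + (\<tau> - 1) / c k" for k using c(1)[of k] by (simp add: field_simps)
      have "t2 + (\<tau> - 1) / c k \<in> {t1..t2}" for k
      proof -
        have "1 - \<tau> \<le> c k * (t2 - t1)" using \<tau> c1(1)[of k] by auto
        then show ?thesis using \<tau> c(1)[of k] by (auto simp: field_simps)
      qed
      then show ?thesis unfolding e using st by (intro *) auto
    qed
    have J: "J k s = (\<integral>t. (c k * S' (c k * t + (- c k * t1))) *\<^sub>R HH (s,t) \<partial>lborel) -
       (\<integral>t. (c k * S' (c k * t + (1 - c k * t2))) *\<^sub>R HH (s,t) \<partial>lborel)" for k
      unfolding J_def A'_def scaleR_left_diff_distrib
      by (intro Bochner_Integration.integral_diff kl(3)[OF _ l1] kl(3)[OF _ l2])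
    have "norm (\<integral>t. (c k * S' (c k * t + (- c k * t1))) *\<^sub>R HH (s,t) \<partial>lborel) \<le> M"
      "norm (\<integral>t. (c k * S' (c k * t + (1 - c k * t2))) *\<^sub>R HH (s,t) \<partial>lborel) \<le> M"
      by (rule kl(2)[OF _ l1] kl(2)[OF _ l2]; simp)+
    then show "norm (J k s) \<le> 2 * M"
      unfolding J by (intro norm_triangle_le_diff) linarith
    assume s: "s \<in> {s1..s2}"
    have "(\<lambda>k. J k s) \<longlonglongrightarrow> HH (s, t1) - HH (s, t2)"
      unfolding J by (intro tendsto_diff kl(1)[OF _ l1] kl(1)[OF _ l2])
    then show "(\<lambda>k. J k s) \<longlonglongrightarrow> H (s, t1) - H (s, t2)"
      using s st by (simp add: HH_def R_def)
  qed
  have lhs_eq: "(\<integral>p. (B k (fst p) * A' k (snd p)) *\<^sub>R HH p \<partial>lborel) = (\<integral>s. B k s *\<^sub>R J k s \<partial>lborel)" for k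
  proof -
    have "continuous_on UNIV (A' k)" unfolding A'_def
      by (intro continuous_intros continuous_on_compose2[OF smooth_real_continuous[OF sS', of UNIV]]) auto
    then have "continuous_on R (\<lambda>p. A' k (snd p))"
      by (rule continuous_on_compose2) (auto intro: continuous_intros)
    moreover have "continuous_on R (\<lambda>p. B k (fst p))"
      by (rule continuous_on_compose2[OF smooth_real_continuous[OF Bp(1), of UNIV]]) (auto intro: continuous_intros)
    moreover have "continuous_on R H" using H by (simp add: R_def)
    ultimately have "continuous_on R (\<lambda>p. (B k (fst p) * A' k (snd p)) *\<^sub>R H p)"
      by (intro continuous_on_scaleR continuous_on_mult)
    then have "integrable lborel (\<lambda>p. indicator R p *\<^sub>R ((B k (fst p) * A' k (snd p)) *\<^sub>R H p))"
      by (intro borel_integrable_compact R)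
    then have "integrable lborel (\<lambda>p. (B k (fst p) * A' k (snd p)) *\<^sub>R HH p)"
      by (simp add: HH_def mult.commute mult.left_commute)
    from lborel_integral_fst(1)[OF this] show ?thesis
      unfolding J_def integral_scaleR_right[symmetric] by simp
  qed
  have "(\<lambda>k. \<integral>s. B k s *\<^sub>R J k s \<partial>lborel) \<longlonglongrightarrow> (\<integral>s. indicator {s1<..<s2} s *\<^sub>R (H (s, t1) - H (s, t2)) \<partial>lborel)"
  proof (rule integral_dominated_convergence[where w = "\<lambda>s. indicator {s1..s2} s *\<^sub>R (2 * M)"])
    have "continuous_on {s1<..<s2} (\<lambda>s. H (s, t1) - H (s, t2))"
      using st by (intro continuous_intros continuous_on_compose2[OF H]) auto
    then show "(\<lambda>s. indicator {s1<..<s2} s *\<^sub>R (H (s, t1) - H (s, t2))) \<in> borel_measurable lborel"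
      using borel_measurable_continuous_on_indicator[of "{s1<..<s2}"] by auto
    show "integrable lborel (\<lambda>s. indicator {s1..s2} s *\<^sub>R (2 * M))"
      by (intro borel_integrable_compact) auto
    show "AE s in lborel. (\<lambda>k. B k s *\<^sub>R J k s) \<longlonglongrightarrow> indicator {s1<..<s2} s *\<^sub>R (H (s, t1) - H (s, t2))"
    proof (rule AE_I2)
      fix s show "(\<lambda>k. B k s *\<^sub>R J k s) \<longlonglongrightarrow> indicator {s1<..<s2} s *\<^sub>R (H (s, t1) - H (s, t2))"
      proof (cases "s \<in> {s1..s2}")
        case True then show ?thesis by (intro tendsto_scaleR Blim Jlim)
      next
        case False
        then have "s \<notin> {s1<..<s2}" by auto
        then show ?thesis using False Bp(4) by simp
      qed
    qed
    show "AE s in lborel. norm (B k s *\<^sub>R J k s) \<le> indicator {s1..s2} s *\<^sub>R (2 * M)" for k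
    proof (rule AE_I2)
      fix s show "norm (B k s *\<^sub>R J k s) \<le> indicator {s1..s2} s *\<^sub>R (2 * M)"
      proof (cases "s \<in> {s1..s2}")
        case True
        have "norm (B k s *\<^sub>R J k s) \<le> 1 * (2 * M)"
          unfolding norm_scaleR using Bp(2,3)[of k s] Jb by (intro mult_mono) auto
        then show ?thesis using True by simp
      next
        case False then show ?thesis using Bp(4) by simp
      qed
    qed
  qed measurable
  moreover have "(\<integral>s. B k s *\<^sub>R J k s \<partial>lborel) = - (\<integral>p. (B k (fst p) * A k (snd p)) *\<^sub>R G p \<partial>lborel)" for k
    unfolding lhs_eq[symmetric] HH_def R_def
    by (intro wk Ap Bp)
  ultimately have "(\<lambda>k. - (\<integral>p. (B k (fst p) * A k (snd p)) *\<^sub>R G p \<partial>lborel)) \<longlonglongrightarrow>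
      (\<integral>s. indicator {s1<..<s2} s *\<^sub>R (H (s, t1) - H (s, t2)) \<partial>lborel)" by simp
  then have "(\<integral>s. indicator {s1<..<s2} s *\<^sub>R (H (s, t1) - H (s, t2)) \<partial>lborel) =
      - (\<integral>p. indicator ({s1<..<s2} \<times> {t1<..<t2}) p *\<^sub>R G p \<partial>lborel)"
    using LIMSEQ_unique tendsto_minus[OF rhs] by blast
  then have "(\<integral>s. - (indicator {s1<..<s2} s *\<^sub>R (H (s, t1) - H (s, t2))) \<partial>lborel) =
      (\<integral>p. indicator ({s1<..<s2} \<times> {t1<..<t2}) p *\<^sub>R G p \<partial>lborel)" by simp
  then show ?thesis
    by (simp add: set_lebesgue_integral_def flip: scaleR_minus_right)
qed

section \<open>Absolute continuity on lines\<close>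

lemma negligible_imp_AE_lborel: "negligible N \<Longrightarrow> AE x in lborel. x \<notin> N"
  using AE_not_in[of N lebesgue] by (simp add: negligible_iff_null_sets AE_completion_iff)

text \<open>The primitive of \<open>D\<close> vanishes identically, yet by Lebesgue differentiation
  its derivative is \<open>D x\<close> almost everywhere.\<close>

lemma zero_ae_if_interval_integrals_zero:
  fixes D :: "real \<Rightarrow> 'b::euclidean_space"
  assumes D: "D integrable_on {c..d}" and z: "\<And>u. c < u \<Longrightarrow> u < d \<Longrightarrow> integral {c..u} D = 0"
  shows "AE x in lborel. x \<in> {c<..<d} \<longrightarrow> D x = 0"
proof -
  obtain N where N: "negligible N"
    "\<And>x. x \<in> {c<..<d} - N \<Longrightarrow> ((\<lambda>u. integral {c..u} D) has_vector_derivative D x) (at x)"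
    using integral_has_vector_derivative_ae[OF D] by blast
  show ?thesis
    using negligible_imp_AE_lborel[OF N(1)]
  proof eventually_elim
    case (elim x)
    show ?case
    proof
      assume x: "x \<in> {c<..<d}"
      have "((\<lambda>u. 0 :: 'b) has_vector_derivative D x) (at x)"
        by (rule has_vector_derivative_transform_within_open[OF N(2), of x "{c<..<d}"]) (use x elim z in auto)
      then show "D x = 0"
        using vector_derivative_unique_at has_vector_derivative_const by blast
    qed
  qed
qed

text \<open>For fixed \<open>t1\<close> and \<open>t2\<close> both sides have equal integrals over
  all intervals of \<open>s\<close>, hence agree for almost every \<open>s\<close>. That null set
  depends on the endpoints; a common one is obtained from rational endpoints, after which continuity
  of \<open>H\<close> and integrability of the section reach all others.\<close>

lemma absolutely_continuous_on_lines:
  fixes H G :: "real \<times> real \<Rightarrow> 'b::euclidean_space"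
  assumes cd: "c < d"
    and H: "continuous_on ({c..d} \<times> {a..b}) H"
    and G: "integrable lborel G"
    and id: "\<And>s1 s2 t1 t2. \<lbrakk>c \<le> s1; s1 < s2; s2 \<le> d; a \<le> t1; t1 < t2; t2 \<le> b\<rbrakk> \<Longrightarrow>
      (LBINT s:{s1<..<s2}. H (s, t2) - H (s, t1)) = (LBINT p:{s1<..<s2} \<times> {t1<..<t2}. G p)"
  shows "AE s in lborel. s \<in> {c<..<d} \<longrightarrow> integrable lborel (\<lambda>t. G (s, t)) \<and>
     (\<forall>t1\<in>{a..b}. \<forall>t2\<in>{a..b}. t1 \<le> t2 \<longrightarrow> H (s, t2) - H (s, t1) = (LBINT t:{t1<..<t2}. G (s, t)))"
proof -
  have Gm: "G \<in> borel_measurable borel" using G by (auto dest: borel_measurable_integrable)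
  have ae: "AE s in lborel. s \<in> {c<..<d} \<longrightarrow> H (s, t2) - H (s, t1) = (LBINT t:{t1<..<t2}. G (s, t))"
    if t: "a \<le> t1" "t1 < t2" "t2 \<le> b" for t1 t2
  proof -
    define Q where "Q s = (LBINT t:{t1<..<t2}. G (s, t))" for s
    have op: "open (A \<times> {t1<..<t2})" if "open A" for A :: "real set"
      using that by (auto intro: open_Times)
    have Gi: "integrable lborel (\<lambda>p. indicator (A \<times> {t1<..<t2}) p *\<^sub>R G p)" if "open A" for A
      using integrable_mult_indicator[OF _ G, of "A \<times> {t1<..<t2}"] op[OF that] by auto
    have Qi: "integrable lborel Q"
      using lborel_integral_fst(2)[OF Gi[of UNIV]]
      by (simp add: Q_def[abs_def] set_lebesgue_integral_def indicator_times)
    have Qint: "(LBINT s:{s1<..<s2}. Q s) = (LBINT p:{s1<..<s2} \<times> {t1<..<t2}. G p)" for s1 s2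
      using lborel_integral_fst(1)[OF Gi[of "{s1<..<s2}"]]
      by (simp add: Q_def[abs_def] set_lebesgue_integral_def indicator_times flip: integral_scaleR_right scaleR_scaleR)
    have Hc: "continuous_on {c..d} (\<lambda>s. H (s, t2) - H (s, t1))"
      using t by (intro continuous_intros continuous_on_compose2[OF H]) auto
    have Hs: "set_integrable lborel {c..u} (\<lambda>s. H (s, t2) - H (s, t1))" if "u \<le> d" for u
      unfolding set_integrable_def using that
      by (intro borel_integrable_compact continuous_on_subset[OF Hc]) auto
    have Hs': "set_integrable lborel {c<..<u} (\<lambda>s. H (s, t2) - H (s, t1))" if "u \<le> d" for u
      by (rule set_integrable_subset[OF Hs[OF that]]) auto
    have Qs: "set_integrable lborel A Q" if "A \<in> sets borel" for A
      unfolding set_integrable_def using integrable_mult_indicator[OF _ Qi, of A] that by simp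
    have "AE s in lborel. s \<in> {c<..<d} \<longrightarrow> H (s, t2) - H (s, t1) - Q s = 0"
    proof (rule zero_ae_if_interval_integrals_zero)
      show "(\<lambda>s. H (s, t2) - H (s, t1) - Q s) integrable_on {c..d}"
        by (intro integrable_diff[OF integrable_continuous_real[OF Hc]] set_borel_integral_eq_integral Qs) auto
      fix u assume u: "c < u" "u < d"
      have "integral {c..u} (\<lambda>s. H (s, t2) - H (s, t1) - Q s) = integral {c<..<u} (\<lambda>s. H (s, t2) - H (s, t1) - Q s)"
        by (rule integral_open_interval_real)
      also have "\<dots> = (LBINT s:{c<..<u}. H (s, t2) - H (s, t1) - Q s)"
        using u by (intro set_borel_integral_eq_integral(2)[symmetric] set_integral_diff Hs' Qs) auto
      also have "\<dots> = (LBINT s:{c<..<u}. H (s, t2) - H (s, t1)) - (LBINT s:{c<..<u}. Q s)"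
        using u by (intro set_integral_diff Hs' Qs) auto
      also have "\<dots> = 0"
        unfolding Qint using id[of c u t1 t2] u t by simp
      finally show "integral {c..u} (\<lambda>s. H (s, t2) - H (s, t1) - Q s) = 0" .
    qed
    then show ?thesis by (rule eventually_mono) (auto simp: Q_def)
  qed
  \<comment> \<open>This is where the null sets are merged: only countably many pairs of endpoints
    occur.\<close>
  have "AE s in lborel. \<forall>p::rat \<times> rat. a \<le> of_rat (fst p) \<longrightarrow> of_rat (fst p) < (of_rat (snd p) :: real) \<longrightarrow> of_rat (snd p) \<le> b \<longrightarrow>
      s \<in> {c<..<d} \<longrightarrow> H (s, of_rat (snd p)) - H (s, of_rat (fst p)) = (LBINT t:{of_rat (fst p)<..<of_rat (snd p)}. G (s, t))"
    unfolding AE_all_countable using ae by (auto intro!: AE_I2)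
  with lborel_integral_fst(3)[OF G] show ?thesis
  proof eventually_elim
    case (elim s)
    show ?case
    proof (intro impI conjI ballI)
      show "integrable lborel (\<lambda>t. G (s, t))" by fact
      assume s: "s \<in> {c<..<d}"
      have rat: "H (s, y) - H (s, x) = (LBINT t:{x<..<y}. G (s, t))" if "x \<in> \<rat>" "y \<in> \<rat>" "a \<le> x" "x < y" "y \<le> b" for x y
        using elim(2) that s by (auto elim!: Rats_cases)
      fix t1 t2 assume t: "t1 \<in> {a..b}" "t2 \<in> {a..b}" "t1 \<le> t2"
      show "H (s, t2) - H (s, t1) = (LBINT t:{t1<..<t2}. G (s, t))"
      proof (cases "t1 = t2")
        case False
        with t have lt: "t1 < t2" by simp
        \<comment> \<open>The midpoint separates the two rational sequences: \<open>x n\<close>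
          decreases in on \<open>t1\<close> below \<open>m\<close> and \<open>y n\<close> approaches
          \<open>t2\<close> above \<open>m\<close>, so every interval (x n, y n) is nonempty and
          lies inside (t1, t2).\<close>
        define m where "m = (t1 + t2) / 2"
        have m: "t1 < m" "m < t2" using lt by (auto simp: m_def)
        have "\<exists>x\<in>\<rat>. t1 < x \<and> x < min m (t1 + 1 / (real n + 1))" for n
          using m by (intro Rats_dense_in_real) auto
        then obtain x where x: "\<And>n. x n \<in> \<rat>" "\<And>n. t1 < x n" "\<And>n. x n < m" "\<And>n. x n < t1 + 1 / (real n + 1)"
          by (metis min_less_iff_conj)
        have "\<exists>x\<in>\<rat>. max m (t2 - 1 / (real n + 1)) < x \<and> x < t2" for n
          using m by (intro Rats_dense_in_real) auto
        then obtain y where y: "\<And>n. y n \<in> \<rat>" "\<And>n. y n < t2" "\<And>n. m < y n" "\<And>n. t2 - 1 / (real n + 1) < y n"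
          by (metis max_less_iff_conj)
        have o: "(\<lambda>n. 1 / (real n + 1)) \<longlonglongrightarrow> 0"
          using lim_inverse_n' LIMSEQ_Suc[of "\<lambda>n. 1 / real n" 0] by (simp add: add.commute)
        have xl: "x \<longlonglongrightarrow> t1"
          by (rule tendsto_sandwich[of "\<lambda>_. t1" _ _ "\<lambda>n. t1 + 1 / (real n + 1)"])
             (use x(2,4) tendsto_add[OF tendsto_const o, of t1] in \<open>auto intro: always_eventually less_imp_le\<close>)
        have yl: "y \<longlonglongrightarrow> t2"
          by (rule tendsto_sandwich[of "\<lambda>n. t2 - 1 / (real n + 1)" _ _ "\<lambda>_. t2"])
             (use y(2,4) tendsto_diff[OF tendsto_const o, of t2] in \<open>auto intro: always_eventually less_imp_le\<close>)
        have xab: "x n \<in> {a..b}" "y n \<in> {a..b}" for n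
          using x(2,3)[of n] y(2,3)[of n] t m by auto
        have Hl: "(\<lambda>n. H (s, u n)) \<longlonglongrightarrow> H (s, v)" if "u \<longlonglongrightarrow> v" "\<And>n. u n \<in> {a..b}" "v \<in> {a..b}" for u v
          by (rule continuous_on_tendsto_compose[OF H]) (use that s in \<open>auto intro!: tendsto_intros\<close>)
        have "(\<lambda>n. H (s, y n) - H (s, x n)) \<longlonglongrightarrow> H (s, t2) - H (s, t1)"
          using t by (intro tendsto_diff Hl xl yl xab)
        moreover have "H (s, y n) - H (s, x n) = (LBINT t:{x n<..<y n}. G (s, t))" for n
          using x(1,3)[of n] y(1,3)[of n] xab[of n] by (intro rat) auto
        moreover have "(\<lambda>n. LBINT t:{x n<..<y n}. G (s, t)) \<longlonglongrightarrow> (LBINT t:{t1<..<t2}. G (s, t))"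
          unfolding set_lebesgue_integral_def
        proof (rule integral_dominated_convergence[where w = "\<lambda>t. norm (G (s, t))"])
          have "(\<lambda>t. G (s, t)) \<in> borel_measurable borel"
            using elim(1) by (auto dest: borel_measurable_integrable)
          then show "(\<lambda>t. indicator {t1<..<t2} t *\<^sub>R G (s, t)) \<in> borel_measurable lborel"
            "\<And>n. (\<lambda>t. indicator {x n<..<y n} t *\<^sub>R G (s, t)) \<in> borel_measurable lborel"
            by auto
          show "integrable lborel (\<lambda>t. norm (G (s, t)))" using elim(1) by simp
          show "AE t in lborel. norm (indicator {x n<..<y n} t *\<^sub>R G (s, t)) \<le> norm (G (s, t))" for n
            by (auto simp: indicator_def)
          show "AE t in lborel. (\<lambda>n. indicator {x n<..<y n} t *\<^sub>R G (s, t)) \<longlonglongrightarrow> indicator {t1<..<t2} t *\<^sub>R G (s, t)"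
          proof (rule AE_I2, rule tendsto_scaleR[OF _ tendsto_const])
            fix t show "(\<lambda>n. indicator {x n<..<y n} t) \<longlonglongrightarrow> (indicator {t1<..<t2} t :: real)"
            proof (cases "t \<in> {t1<..<t2}")
              case True
              then have "\<forall>\<^sub>F n in sequentially. x n < t" "\<forall>\<^sub>F n in sequentially. t < y n"
                using order_tendstoD[OF xl] order_tendstoD[OF yl] by auto
              then have "\<forall>\<^sub>F n in sequentially. indicator {x n<..<y n} t = (1 :: real)"
                by eventually_elim simp
              then show ?thesis using True by (simp add: tendsto_eventually)
            next
              case False
              then have "indicator {x n<..<y n} t = (0::real)" for n
                using x(2)[of n] y(2)[of n] by (auto simp: indicator_def)
              then show ?thesis using False by simp
            qed
          qed
        qed
        ultimately show ?thesis using LIMSEQ_unique by simp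
      qed (simp add: set_lebesgue_integral_def)
    qed
  qed
qed

section \<open>Rectifiable curves and indefinite integrals\<close>

text \<open>\<Phi> bounds the arc length. A fine subdivision covers the curve by balls whose radii
  are at most \<epsilon> and add up to at most the total increase \<open>T\<close> of \<Phi>. In
  dimension at least 2 their volume is at most a constant times \<epsilon> \<open>T\<close>, which
  is arbitrarily small.\<close>

lemma negligible_rectifiable_image:
  fixes \<gamma> :: "real \<Rightarrow> 'b::euclidean_space" and \<Phi> :: "real \<Rightarrow> real"
  assumes dim: "DIM('b) \<ge> 2" and cont: "continuous_on {a..b} \<gamma>"
    and var: "\<And>s t. \<lbrakk>a \<le> s; s \<le> t; t \<le> b\<rbrakk> \<Longrightarrow> norm (\<gamma> t - \<gamma> s) \<le> \<Phi> t - \<Phi> s"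
  shows "negligible (\<gamma> ` {a..b})"
proof (cases "a < b")
  case False
  then have "{a..b} = {} \<or> {a..b} = {a}" by auto
  then show ?thesis by auto
next
  case ab: True
  show ?thesis unfolding negligible_outer_le
  proof (intro allI impI)
    fix e :: real assume e: "e > 0"
    define V where "V = unit_ball_vol (real DIM('b))"
    have V: "V > 0" unfolding V_def by simp
    define T where "T = \<Phi> b - \<Phi> a"
    have T: "T \<ge> 0" using var[of a b] ab norm_ge_zero[of "\<gamma> b - \<gamma> a"] unfolding T_def by linarith
    \<comment> \<open>The bound 1 permits replacing the power \<open>DIM('b)\<close> of a radius by
      its square. The denominator contains \<open>T + 1\<close> because \<open>T\<close> may be
      zero.\<close>
    define \<epsilon> where "\<epsilon> = min 1 (e / (V * (T + 1)))"
    have \<epsilon>: "\<epsilon> > 0" "\<epsilon> \<le> 1" and \<epsilon>e: "V * (\<epsilon> * T) \<le> e"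
    proof -
      show "\<epsilon> > 0" "\<epsilon> \<le> 1" using e V T by (auto simp: \<epsilon>_def)
      have "\<epsilon> \<le> e / (V * (T + 1))" by (simp add: \<epsilon>_def)
      then have "\<epsilon> * (V * (T + 1)) \<le> e" using V T by (simp add: pos_le_divide_eq)
      moreover have "V * (\<epsilon> * T) \<le> \<epsilon> * (V * (T + 1))" using V T \<open>\<epsilon> > 0\<close> by (simp add: algebra_simps)
      ultimately show "V * (\<epsilon> * T) \<le> e" by linarith
    qed
    have "uniformly_continuous_on {a..b} \<gamma>" using cont by (intro compact_uniformly_continuous) auto
    then obtain \<delta> where \<delta>: "\<delta> > 0" "\<And>x y. \<lbrakk>x \<in> {a..b}; y \<in> {a..b}; dist y x < \<delta>\<rbrakk> \<Longrightarrow> dist (\<gamma> y) (\<gamma> x) < \<epsilon>"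
      using \<epsilon> unfolding uniformly_continuous_on_def by metis
    obtain n where n: "n > 0" "(b - a) / real n < \<delta>"
    proof -
      obtain n where "(b - a) / \<delta> < real n" using reals_Archimedean2 by blast
      moreover have "(b - a) / \<delta> > 0" using ab \<delta> by simp
      ultimately have "real n > 0" by linarith
      moreover from this have "(b - a) / real n < \<delta>"
        using \<open>(b - a) / \<delta> < real n\<close> \<delta>(1) by (simp add: divide_less_eq mult.commute)
      ultimately show thesis by (intro that[of n]) auto
    qed
    define h where "h = (b - a) / real n"
    have h: "h > 0" "h < \<delta>" "real n * h = b - a" using n ab by (auto simp: h_def)
    define t where "t i = a + real i * h" for i
    have ti: "a \<le> t i" "t i \<le> t (Suc i)" for i using h by (auto simp: t_def algebra_simps)
    have tb: "t i \<le> b" if "i \<le> n" for i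
      using mult_right_mono[of "real i" "real n" h] that h by (simp add: t_def)
    have tn: "t n = b" "t 0 = a" using h by (auto simp: t_def)
    \<comment> \<open>Both bounds are used in the square of the radius: one factor is estimated by
      \<epsilon>, the other by the increment of \<Phi>, which telescopes.\<close>
    define r where "r i = min \<epsilon> (\<Phi> (t (Suc i)) - \<Phi> (t i))" for i
    have r: "r i \<ge> 0" if "i < n" for i
      using var[of "t i" "t (Suc i)"] ti[of i] tb[of "Suc i"] that \<epsilon> norm_ge_zero[of "\<gamma> (t (Suc i)) - \<gamma> (t i)"]
      unfolding r_def by linarith
    have sub: "\<gamma> ` {a..b} \<subseteq> (\<Union>i<n. cball (\<gamma> (t i)) (r i))"
    proof (clarify)
      fix x assume x: "x \<in> {a..b}"
      have "\<exists>i<n. t i \<le> x \<and> x \<le> t (Suc i)"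
      proof (cases "x = b")
        case True
        have "t (n - 1) \<le> t n" using ti(2)[of "n - 1"] n by simp
        then show ?thesis using True n tn by (intro exI[of _ "n - 1"]) auto
      next
        case False
        define j where "j = nat \<lfloor>(x - a) / h\<rfloor>"
        have "(x - a) / h \<ge> 0" using x h by simp
        then have j: "real j \<le> (x - a) / h" "(x - a) / h < real j + 1"
          unfolding j_def by linarith+
        then have 1: "t j \<le> x" "x \<le> t (Suc j)" using h by (auto simp: t_def field_simps)
        have "x < b" using x False by auto
        then have "real j * h < real n * h" using 1(1) h unfolding t_def by linarith
        then have "real j < real n" using h(1) by (simp only: mult_less_cancel_right_pos)
        then have "j < n" by simp
        with 1 show ?thesis by blast
      qed
      then obtain i where i: "i < n" "t i \<le> x" "x \<le> t (Suc i)" by blast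
      have tS: "t (Suc i) \<le> b" using tb[of "Suc i"] i by simp
      have "norm (\<gamma> x - \<gamma> (t i)) \<le> \<Phi> x - \<Phi> (t i)" using var[of "t i" x] i ti[of i] x by simp
      also have "\<dots> \<le> \<Phi> (t (Suc i)) - \<Phi> (t i)"
        using var[of x "t (Suc i)"] i x tS order_trans[OF norm_ge_zero] by fastforce
      finally have A: "dist (\<gamma> (t i)) (\<gamma> x) \<le> \<Phi> (t (Suc i)) - \<Phi> (t i)" by (simp add: dist_norm norm_minus_commute)
      have "dist (t i) x < \<delta>" using i h by (auto simp: dist_real_def t_def algebra_simps)
      then have "dist (\<gamma> (t i)) (\<gamma> x) < \<epsilon>"
        using i x ti[of i] by (intro \<delta>(2)) auto
      with A i show "\<gamma> x \<in> (\<Union>i<n. cball (\<gamma> (t i)) (r i))"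
        by (auto simp: r_def intro!: bexI[of _ i])
    qed
    let ?T = "\<Union>i<n. cball (\<gamma> (t i)) (r i)"
    have "?T \<in> lmeasurable" by (intro fmeasurable.finite_UN) auto
    moreover have "measure lebesgue ?T \<le> e"
    proof -
      have "measure lebesgue ?T \<le> (\<Sum>i<n. measure lebesgue (cball (\<gamma> (t i)) (r i)))"
        by (intro measure_UNION_le) auto
      also have "\<dots> = (\<Sum>i<n. V * r i ^ DIM('b))"
        using r by (intro sum.cong) (auto simp: V_def content_cball)
      also have "\<dots> \<le> (\<Sum>i<n. V * (\<epsilon> * (\<Phi> (t (Suc i)) - \<Phi> (t i))))"
      proof (intro sum_mono mult_left_mono)
        fix i assume "i \<in> {..<n}"
        then have ri: "r i \<ge> 0" "r i \<le> \<epsilon>" "r i \<le> \<Phi> (t (Suc i)) - \<Phi> (t i)" using r by (auto simp: r_def)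
        have "r i ^ DIM('b) \<le> r i ^ 2"
          using ri \<epsilon> dim by (intro power_decreasing) auto
        also have "\<dots> \<le> \<epsilon> * (\<Phi> (t (Suc i)) - \<Phi> (t i))"
          unfolding power2_eq_square using ri \<epsilon> by (intro mult_mono) auto
        finally show "r i ^ DIM('b) \<le> \<epsilon> * (\<Phi> (t (Suc i)) - \<Phi> (t i))" .
      qed (use V in auto)
      also have "\<dots> = V * (\<epsilon> * (\<Sum>i<n. \<Phi> (t (Suc i)) - \<Phi> (t i)))"
        by (simp add: sum_distrib_left)
      also have "(\<Sum>i<n. \<Phi> (t (Suc i)) - \<Phi> (t i)) = T"
        using sum_lessThan_telescope[of "\<lambda>i. \<Phi> (t i)" n] by (simp add: tn T_def)
      finally show ?thesis using \<epsilon>e by linarith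
    qed
    ultimately show "\<exists>T. \<gamma> ` {a..b} \<subseteq> T \<and> T \<in> lmeasurable \<and> measure lebesgue T \<le> e"
      using sub by blast
  qed
qed

text \<open>The integral of \<open>norm (f x)\<close> up to the current parameter plays the role of
  the arc length bound.\<close>

lemma negligible_image_of_indefinite_integral:
  fixes \<gamma> f :: "real \<Rightarrow> 'b::euclidean_space"
  assumes "DIM('b) \<ge> 2" "continuous_on {a..b} \<gamma>" and f: "integrable lborel f"
    and eq: "\<forall>t1\<in>{a..b}. \<forall>t2\<in>{a..b}. t1 \<le> t2 \<longrightarrow> \<gamma> t2 - \<gamma> t1 = (LBINT t:{t1<..<t2}. f t)"
  shows "negligible (\<gamma> ` {a..b})"
proof (rule negligible_rectifiable_image[OF assms(1,2)])
  fix s t assume st: "a \<le> s" "s \<le> t" "t \<le> b"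
  have i: "integrable lborel (\<lambda>x. indicator A x *\<^sub>R norm (f x))" if "A \<in> sets borel" for A
    using integrable_mult_indicator[of A lborel "\<lambda>x. norm (f x)"] f that by simp
  have "norm (\<gamma> t - \<gamma> s) = norm (\<integral>x. indicator {s<..<t} x *\<^sub>R f x \<partial>lborel)"
    using eq st by (simp add: set_lebesgue_integral_def)
  also have "\<dots> \<le> (\<integral>x. norm (indicator {s<..<t} x *\<^sub>R f x) \<partial>lborel)"
    by (rule integral_norm_bound)
  \<comment> \<open>Half-lines make the bound a difference of two values of a single function of the
    parameter. The difference of the indicators is that of [s,t), which contains the interval
    (s,t).\<close>
  also have "\<dots> \<le> (\<integral>x. indicator {..<t} x *\<^sub>R norm (f x) - indicator {..<s} x *\<^sub>R norm (f x) \<partial>lborel)"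
    using st by (intro integral_mono Bochner_Integration.integrable_diff i integrable_norm
        integrable_mult_indicator f) (auto simp: indicator_def)
  also have "\<dots> = (\<integral>x. indicator {..<t} x *\<^sub>R norm (f x) \<partial>lborel) - (\<integral>x. indicator {..<s} x *\<^sub>R norm (f x) \<partial>lborel)"
    by (intro Bochner_Integration.integral_diff i) auto
  finally show "norm (\<gamma> t - \<gamma> s) \<le> (\<integral>x. indicator {..<t} x *\<^sub>R norm (f x) \<partial>lborel) - (\<integral>x. indicator {..<s} x *\<^sub>R norm (f x) \<partial>lborel)" .
qed

lemma derivative_ae_of_indefinite_integral:
  fixes \<gamma> f :: "real \<Rightarrow> 'b::euclidean_space"
  assumes f: "integrable lborel f"
    and eq: "\<forall>t1\<in>{a..b}. \<forall>t2\<in>{a..b}. t1 \<le> t2 \<longrightarrow> \<gamma> t2 - \<gamma> t1 = (LBINT t:{t1<..<t2}. f t)"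
  shows "AE t in lborel. t \<in> {a<..<b} \<longrightarrow> (\<gamma> has_vector_derivative f t) (at t)"
proof -
  have fi: "set_integrable lborel A f" if "A \<in> sets borel" for A
    unfolding set_integrable_def using integrable_mult_indicator[OF _ f, of A] that by simp
  have "f integrable_on {a..b}" by (intro set_borel_integral_eq_integral fi) auto
  then obtain N where N: "negligible N"
    "\<And>x. x \<in> {a<..<b} - N \<Longrightarrow> ((\<lambda>u. integral {a..u} f) has_vector_derivative f x) (at x)"
    using integral_has_vector_derivative_ae by blast
  show ?thesis
    using negligible_imp_AE_lborel[OF N(1)]
  proof eventually_elim
    case (elim t)
    show ?case
    proof
      assume t: "t \<in> {a<..<b}"
      have I: "\<gamma> u = integral {a..u} f + \<gamma> a" if "u \<in> {a<..<b}" for u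
      proof -
        have "integral {a..u} f = (LBINT t:{a<..<u}. f t)"
          unfolding integral_open_interval_real by (rule set_borel_integral_eq_integral(2)[symmetric, OF fi]) auto
        then show ?thesis using eq that by (auto simp: algebra_simps)
      qed
      have "((\<lambda>u. integral {a..u} f + \<gamma> a) has_vector_derivative f t) (at t)"
        unfolding has_vector_derivative_add_const using N(2) t elim by blast
      then show "(\<gamma> has_vector_derivative f t) (at t)"
        by (rule has_vector_derivative_transform_within_open[of _ _ _ "{a<..<b}"]) (use t I in auto)
    qed
  qed
qed

section \<open>Partial derivatives almost everywhere\<close>

text \<open>Differentiability at a point is reduced to countably many conditions, so that the set
  where it holds becomes measurable. Rational increments are enough because the curve is
  continuous.\<close>

lemma has_vector_derivative_rational_quotients:
  fixes \<gamma> :: "real \<Rightarrow> 'b::real_normed_vector"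
  assumes cont: "continuous_on {a..b} \<gamma>" and t: "t \<in> {a<..<b}"
  shows "(\<gamma> has_vector_derivative f') (at t) \<longleftrightarrow>
    (\<forall>n::nat. \<exists>k::nat. \<forall>q::rat. \<bar>of_rat q\<bar> < 1 / (real k + 1) \<longrightarrow> t + of_rat q \<in> {a..b} \<longrightarrow>
       norm (\<gamma> (t + of_rat q) - \<gamma> t - of_rat q *\<^sub>R f') \<le> \<bar>of_rat q\<bar> / (real n + 1))"
    (is "_ \<longleftrightarrow> (\<forall>n. \<exists>k. ?P n k)")
proof
  assume d: "(\<gamma> has_vector_derivative f') (at t)"
  show "\<forall>n. \<exists>k. ?P n k"
  proof
    fix n :: nat
    have "1 / (real n + 1) > 0" by simp
    then obtain \<delta> where \<delta>: "\<delta> > 0" "\<And>y. norm (y - t) < \<delta> \<Longrightarrow>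
        norm (\<gamma> y - \<gamma> t - (y - t) *\<^sub>R f') \<le> 1 / (real n + 1) * norm (y - t)"
      using d unfolding has_vector_derivative_def has_derivative_at_alt by blast
    obtain k where "1 / (real k + 1) < \<delta>"
      using \<delta>(1) by (metis add.commute inverse_eq_divide of_nat_Suc reals_Archimedean)
    then have "?P n k" using \<delta>(2)[of "t + of_rat q" for q] by auto
    then show "\<exists>k. ?P n k" ..
  qed
next
  assume P: "\<forall>n. \<exists>k. ?P n k"
  show "(\<gamma> has_vector_derivative f') (at t)"
    unfolding has_vector_derivative_def has_derivative_at_alt
  proof (intro conjI allI impI)
    show "bounded_linear (\<lambda>h. h *\<^sub>R f')" by (rule bounded_linear_scaleR_left)
    fix e :: real assume "e > 0"
    then obtain n where n: "1 / (real n + 1) < e"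
      by (metis add.commute inverse_eq_divide of_nat_Suc reals_Archimedean)
    from P obtain k where k: "?P n k" by blast
    define \<delta> where "\<delta> = min (1 / (real k + 1)) (min (t - a) (b - t))"
    have \<delta>: "\<delta> > 0" using t by (auto simp: \<delta>_def)
    show "\<exists>d>0. \<forall>y. norm (y - t) < d \<longrightarrow> norm (\<gamma> y - \<gamma> t - (y - t) *\<^sub>R f') \<le> e * norm (y - t)"
    proof (intro exI[of _ \<delta>] conjI allI impI \<delta>)
      fix y assume y: "norm (y - t) < \<delta>"
      let ?I = "{a<..<b} \<inter> ball t \<delta>"
      have yI: "y \<in> ?I" using y t by (auto simp: \<delta>_def dist_real_def)
      have ne: "norm (\<gamma> z - \<gamma> t - (z - t) *\<^sub>R f') - 1 / (real n + 1) * norm (z - t) \<le> 0" if zI: "z \<in> ?I" for z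
      proof -
        \<comment> \<open>Density is taken relative to \<open>t\<close>: these are the points at
          rational distance from \<open>t\<close>, not the rational points. The difference of both
          sides of the estimate is continuous, so its sign passes to the limit.\<close>
        let ?D = "{z \<in> ?I. z - t \<in> \<rat>}"
        have dense: "z \<in> closure ?D"
          unfolding closure_approachable
        proof (intro allI impI)
          fix \<epsilon> :: real assume \<epsilon>: "\<epsilon> > 0"
          have "open ?I" by (intro open_Int) auto
          then obtain \<rho> where \<rho>: "\<rho> > 0" "ball z \<rho> \<subseteq> ?I" using zI by (meson openE)
          obtain q where q: "q \<in> \<rat>" "z - t < q" "q < z - t + min \<rho> \<epsilon>"
            using Rats_dense_in_real[of "z - t" "z - t + min \<rho> \<epsilon>"] \<rho> \<epsilon> by auto
          have "t + q \<in> ball z \<rho>" "dist (t + q) z < \<epsilon>" using q by (auto simp: dist_real_def)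
          then show "\<exists>y\<in>?D. dist y z < \<epsilon>" using \<rho> q(1) by (intro bexI[of _ "t + q"]) auto
        qed
        let ?g = "\<lambda>z. norm (\<gamma> z - \<gamma> t - (z - t) *\<^sub>R f') - 1 / (real n + 1) * norm (z - t)"
        have cg: "continuous_on ?I ?g"
          by (intro continuous_intros continuous_on_subset[OF cont]) auto
        obtain x where x: "\<And>n. x n \<in> ?D" "x \<longlonglongrightarrow> z" using dense unfolding closure_sequential by blast
        have "(\<lambda>n. ?g (x n)) \<longlonglongrightarrow> ?g z"
          by (rule continuous_on_tendsto_compose[OF cg x(2) that]) (use x(1) in auto)
        moreover have "?g (x n) \<le> 0" for n
        proof -
          obtain q where q: "x n - t = of_rat q" using x(1)[of n] by (auto elim: Rats_cases)
          then have "x n = t + of_rat q" by simp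
          moreover have "\<bar>of_rat q\<bar> < 1 / (real k + 1)" "t + of_rat q \<in> {a..b}"
            using x(1)[of n] q calculation by (auto simp: \<delta>_def dist_real_def)
          ultimately show ?thesis using k by auto
        qed
        ultimately show ?thesis by (intro LIMSEQ_le_const2[of _ "?g z" 0]) auto
      qed
      have "1 / (real n + 1) * norm (y - t) \<le> e * norm (y - t)" using n by (intro mult_right_mono) auto
      then show "norm (\<gamma> y - \<gamma> t - (y - t) *\<^sub>R f') \<le> e * norm (y - t)" using ne[OF yI] by linarith
    qed
  qed
qed

text \<open>Passing from almost every point on almost every line to almost every point of the plane
  needs a measurable exceptional set. The predicate \<open>P\<close> rewrites differentiability by
  rational difference quotients of the Borel extension \<open>HH\<close>, which settles
  measurability.\<close>

lemma partial_derivative_ae: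
  fixes H G :: "real \<times> real \<Rightarrow> 'b::euclidean_space"
  assumes H: "continuous_on ({c..d} \<times> {a..b}) H" and G: "integrable lborel G"
    and lines: "AE s in lborel. s \<in> {c<..<d} \<longrightarrow> (AE t in lborel. t \<in> {a<..<b} \<longrightarrow>
       ((\<lambda>u. H (s, u)) has_vector_derivative G (s, t)) (at t))"
  shows "AE p in lborel. p \<in> {c<..<d} \<times> {a<..<b} \<longrightarrow>
       ((\<lambda>u. H (fst p, u)) has_vector_derivative G p) (at (snd p))"
proof -
  define R where "R = {c..d} \<times> {a..b}"
  define HH where "HH p = indicator R p *\<^sub>R H p" for p
  have "HH \<in> borel_measurable borel"
    unfolding HH_def using H
    by (intro borel_measurable_continuous_on_indicator) (auto simp: R_def borel_closed closed_Times)
  then have [measurable]: "HH \<in> borel_measurable (borel \<Otimes>\<^sub>M borel)" by (simp add: borel_prod)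
  have [measurable]: "G \<in> borel_measurable (borel \<Otimes>\<^sub>M borel)"
    using G by (auto dest: borel_measurable_integrable simp: borel_prod)
  define P where "P p \<longleftrightarrow> fst p \<in> {c<..<d} \<longrightarrow> snd p \<in> {a<..<b} \<longrightarrow>
     (\<forall>n::nat. \<exists>k::nat. \<forall>q::rat. \<bar>of_rat q\<bar> < 1 / (real k + 1) \<longrightarrow> snd p + of_rat q \<in> {a..b} \<longrightarrow>
       norm (HH (fst p, snd p + of_rat q) - HH (fst p, snd p) - of_rat q *\<^sub>R G (fst p, snd p)) \<le> \<bar>of_rat q\<bar> / (real n + 1))" for p
  have iff: "P (s, t) \<longleftrightarrow> ((\<lambda>u. H (s, u)) has_vector_derivative G (s, t)) (at t)"
    if "s \<in> {c<..<d}" "t \<in> {a<..<b}" for s t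
  proof -
    have "continuous_on {a..b} (\<lambda>u. H (s, u))"
      using that by (intro continuous_on_compose2[OF H] continuous_intros) auto
    from has_vector_derivative_rational_quotients[OF this that(2), of "G (s,t)"] that
    show ?thesis by (simp add: P_def HH_def R_def cong: imp_cong)
  qed
  have meas: "{p \<in> space (borel \<Otimes>\<^sub>M borel). P p} \<in> sets (borel \<Otimes>\<^sub>M borel)"
    unfolding P_def by measurable
  have "AE p in lborel \<Otimes>\<^sub>M lborel. P p"
  proof (rule lborel_pair.AE_pair_measure)
    show "{p \<in> space (lborel \<Otimes>\<^sub>M lborel). P p} \<in> sets (lborel \<Otimes>\<^sub>M lborel)"
      using meas by (simp add: space_pair_measure cong: sets_pair_measure_cong)
    show "AE s in lborel. AE t in lborel. P (s, t)"
      using lines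
    proof eventually_elim
      case (elim s)
      show ?case
      proof (cases "s \<in> {c<..<d}")
        case True
        with elim have "AE t in lborel. t \<in> {a<..<b} \<longrightarrow> ((\<lambda>u. H (s, u)) has_vector_derivative G (s, t)) (at t)" by blast
        then show ?thesis
          by (rule eventually_mono) (use True iff in \<open>auto simp: P_def\<close>)
      qed (auto simp: P_def)
    qed
  qed
  then show ?thesis
    unfolding lborel_prod by (rule eventually_mono) (use iff in auto)
qed

section \<open>Coordinates on the complex plane\<close>

text \<open>Fubini is applied on pairs of reals, while \<open>h\<close> lives on the complex plane.
  The two Lebesgue measures correspond because they give every box the same volume.\<close>

lemma complex_lborel_conv_pair:
  "lborel = distr (lborel :: (real \<times> real) measure) borel (\<lambda>p. Complex (fst p) (snd p))"
proof (rule lborel_eqI)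
  let ?C = "\<lambda>p. Complex (fst p) (snd p)"
  have m: "?C \<in> borel_measurable lborel"
    by (auto intro!: borel_measurable_continuous_onI continuous_intros simp: Complex_eq)
  fix l u :: complex assume lu: "\<And>b. b \<in> Basis \<Longrightarrow> l \<bullet> b \<le> u \<bullet> b"
  have "?C -` box l u = box (Re l, Im l) (Re u, Im u)"
    by (auto simp: mem_box Basis_complex_def Basis_prod_def)
  then have "emeasure (distr lborel borel ?C) (box l u) = emeasure lborel (box (Re l, Im l) (Re u, Im u))"
    using m by (simp add: emeasure_distr)
  also have "\<dots> = (\<Prod>b\<in>Basis. ((Re u, Im u) - (Re l, Im l)) \<bullet> b)"
    using lu[of 1] lu[of \<i>] by (intro emeasure_lborel_box) (auto simp: Basis_complex_def Basis_prod_def)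
  also have "\<dots> = (\<Prod>b\<in>Basis. (u - l) \<bullet> b)"
    by (simp add: Basis_complex_def Basis_prod_def complex_eq_iff mult.commute)
  finally show "emeasure (distr lborel borel ?C) (box l u) = (\<Prod>b\<in>Basis. (u - l) \<bullet> b)" .
qed simp

lemma pair_lborel_swap:
  "lborel = distr (lborel :: (real \<times> real) measure) borel (\<lambda>p. (snd p, fst p))"
proof -
  have "distr (lborel :: (real \<times> real) measure) (lborel \<Otimes>\<^sub>M lborel) (\<lambda>(x,y). (y,x)) = lborel \<Otimes>\<^sub>M lborel"
    using lborel_pair.distr_pair_swap[where 'a=real and 'b=real] by (simp add: lborel_prod)
  moreover have "distr (lborel :: (real \<times> real) measure) (lborel \<Otimes>\<^sub>M lborel) (\<lambda>(x,y). (y,x)) =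
      distr lborel borel (\<lambda>p. (snd p, fst p))"
    unfolding lborel_prod by (intro distr_cong) auto
  ultimately show ?thesis
    by (simp add: lborel_prod)
qed

lemma complex_lborel_conv_swapped_pair:
  "lborel = distr (lborel :: (real \<times> real) measure) borel (\<lambda>p. Complex (snd p) (fst p))"
proof -
  have "lborel = distr (distr (lborel :: (real \<times> real) measure) borel (\<lambda>p. (snd p, fst p))) borel (\<lambda>p. Complex (fst p) (snd p))"
    using complex_lborel_conv_pair pair_lborel_swap by simp
  also have "\<dots> = distr lborel borel ((\<lambda>p. Complex (fst p) (snd p)) \<circ> (\<lambda>p. (snd p, fst p)))"
    by (intro distr_distr) (auto intro!: borel_measurable_continuous_onI continuous_intros simp: Complex_eq)
  finally show ?thesis by (simp add: o_def)
qed

text \<open>Both directions are treated at once: \<open>e\<close> is the direction of differentiation, and in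
  \<open>\<iota> (s, t)\<close> the first coordinate \<open>s\<close> labels the line parallel to \<open>e\<close>, the second moves along it.\<close>
definition axis_frame ::
  "complex \<Rightarrow> (real \<times> real \<Rightarrow> complex) \<Rightarrow> (complex \<Rightarrow> real) \<Rightarrow> (complex \<Rightarrow> real) \<Rightarrow> bool" where
  "axis_frame e \<iota> \<sigma> \<tau> \<longleftrightarrow>
     (e = 1 \<and> \<iota> = (\<lambda>p. Complex (snd p) (fst p)) \<and> \<sigma> = Im \<and> \<tau> = Re) \<or>
     (e = \<i> \<and> \<iota> = (\<lambda>p. Complex (fst p) (snd p)) \<and> \<sigma> = Re \<and> \<tau> = Im)"

lemma axis_frame_coordinates:
  assumes "axis_frame e \<iota> \<sigma> \<tau>"
  shows "\<iota> (\<sigma> z, \<tau> z) = z" "\<sigma> (\<iota> p) = fst p" "\<tau> (\<iota> p) = snd p"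
    "continuous_on A \<iota>" "continuous_on B \<sigma>" "continuous_on B \<tau>"
    "\<iota> \<in> borel_measurable borel" "lborel = distr lborel borel \<iota>"
proof -
  show "\<iota> (\<sigma> z, \<tau> z) = z" "\<sigma> (\<iota> p) = fst p" "\<tau> (\<iota> p) = snd p"
    "continuous_on B \<sigma>" "continuous_on B \<tau>"
    using assms by (auto simp: axis_frame_def intro!: continuous_intros)
  show c: "continuous_on A \<iota>" for A
    using assms by (auto simp: axis_frame_def Complex_eq intro!: continuous_intros)
  show "\<iota> \<in> borel_measurable borel" by (rule borel_measurable_continuous_onI[OF c])
  show "lborel = distr lborel borel \<iota>"
    using assms complex_lborel_conv_pair complex_lborel_conv_swapped_pair by (auto simp: axis_frame_def)
qed

lemma axis_frame_tensor:
  assumes fr: "axis_frame e \<iota> \<sigma> \<tau>" and A: "smooth_real A" "\<And>x. (A has_real_derivative A' x) (at x)"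
    and B: "smooth_real B"
  shows "smooth_fun (\<lambda>z. B (\<sigma> z) * A (\<tau> z))"
    "frechet_derivative (\<lambda>z. B (\<sigma> z) * A (\<tau> z)) (at z) e = B (\<sigma> z) * A' (\<tau> z)"
proof -
  obtain B' where B': "\<And>x. (B has_real_derivative B' x) (at x)"
    using smooth_real_obtain_derivative[OF B] by blast
  have comm: "(\<lambda>z. B (Im z) * A (Re z)) = (\<lambda>z. A (Re z) * B (Im z))" by (simp add: mult.commute)
  show "smooth_fun (\<lambda>z. B (\<sigma> z) * A (\<tau> z))"
    using fr smooth_fun_tensor[OF A(1) B] smooth_fun_tensor[OF B A(1)]
    by (auto simp: axis_frame_def comm)
  show "frechet_derivative (\<lambda>z. B (\<sigma> z) * A (\<tau> z)) (at z) e = B (\<sigma> z) * A' (\<tau> z)"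
    using fr frechet_derivative_tensor[OF A(2) B'] frechet_derivative_tensor[OF B' A(2)]
    by (auto simp: axis_frame_def comm)
qed

text \<open>The weak derivative is only Lebesgue measurable, whereas Fubini over
  \<open>lborel\<close> calls for a Borel function. Integrability follows from |g| \<le> 1 + |g|^2
  on a set of finite measure.\<close>

lemma L2_on_borel_representative:
  assumes X: "bounded X" "open X" and g: "L2_on X g"
  obtains g' where "g' \<in> borel_measurable borel" "integrable lborel g'"
    "AE z in lborel. indicator X z *\<^sub>R g z = g' z"
proof -
  define G where "G z = indicator X z *\<^sub>R g z" for z
  have Gm: "G \<in> borel_measurable lebesgue"
    using g by (simp add: G_def[abs_def] L2_on_def set_borel_measurable_def)
  have "(\<lambda>z. Re (G z)) \<in> borel_measurable lebesgue" "(\<lambda>z. Im (G z)) \<in> borel_measurable lebesgue"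
    using Gm by (simp_all add: borel_measurable_complex_iff)
  then obtain r i where r: "r \<in> borel_measurable lborel" "AE z in lborel. Re (G z) = r z"
    and i: "i \<in> borel_measurable lborel" "AE z in lborel. Im (G z) = i z"
    using completion_ex_borel_measurable_real by metis
  define g' where "g' z = Complex (r z) (i z)" for z
  have g'm: "g' \<in> borel_measurable borel"
    using r(1) i(1) by (simp add: borel_measurable_complex_iff g'_def)
  have ae: "AE z in lborel. G z = g' z"
    using r(2) i(2) by eventually_elim (simp add: g'_def complex_eq_iff)
  have "X \<in> lmeasurable" using X lmeasurable_open by blast
  then have "integrable lebesgue (\<lambda>z. indicator X z *\<^sub>R (1::real))"
    using integrable_real_indicator[of X lebesgue] by (auto simp: fmeasurable_def)
  then have "integrable lebesgue (\<lambda>z. indicator X z *\<^sub>R (1::real) + indicator X z *\<^sub>R (cmod (g z))\<^sup>2)"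
    using g by (intro Bochner_Integration.integrable_add) (auto simp: L2_on_def set_integrable_def)
  then have "integrable lebesgue G"
  proof (rule Bochner_Integration.integrable_bound[OF _ Gm])
    have "cmod (g z) \<le> 1 + (cmod (g z))\<^sup>2" for z
    proof -
      have "2 * cmod (g z) \<le> (cmod (g z))\<^sup>2 + 1"
        using zero_le_power2[of "cmod (g z) - 1"] by (simp add: power2_diff)
      then show ?thesis using norm_ge_zero[of "g z"] by linarith
    qed
    then show "AE z in lebesgue. norm (G z) \<le> norm (indicator X z *\<^sub>R (1::real) + indicator X z *\<^sub>R (cmod (g z))\<^sup>2)"
      by (auto simp: G_def indicator_def)
  qed
  moreover have "integrable lebesgue G \<longleftrightarrow> integrable lebesgue g'"
    by (rule integrable_cong_AE[OF Gm _ AE_completion[OF ae]]) (use g'm in \<open>auto intro: measurable_completion\<close>)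
  ultimately have "integrable lebesgue g'" by blast
  then have "integrable lborel g'" using integrable_completion[of g' lborel] g'm by simp
  with g'm ae show thesis by (intro that[of g']) (auto simp: G_def)
qed

lemma axis_rectangle:
  assumes fr: "axis_frame e \<iota> \<sigma> \<tau>"
  shows "compact (\<iota> ` ({c..d} \<times> {a..b}))" "z \<in> \<iota> ` ({c..d} \<times> {a..b}) \<longleftrightarrow> \<sigma> z \<in> {c..d} \<and> \<tau> z \<in> {a..b}"
proof -
  note co = axis_frame_coordinates[OF fr]
  show "compact (\<iota> ` ({c..d} \<times> {a..b}))"
    by (intro compact_continuous_image co compact_Times) auto
  show "z \<in> \<iota> ` ({c..d} \<times> {a..b}) \<longleftrightarrow> \<sigma> z \<in> {c..d} \<and> \<tau> z \<in> {a..b}"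
  proof
    assume "z \<in> \<iota> ` ({c..d} \<times> {a..b})"
    then show "\<sigma> z \<in> {c..d} \<and> \<tau> z \<in> {a..b}" by (auto simp: co(2,3))
  next
    assume "\<sigma> z \<in> {c..d} \<and> \<tau> z \<in> {a..b}"
    then show "z \<in> \<iota> ` ({c..d} \<times> {a..b})"
      by (intro image_eqI[of z \<iota> "(\<sigma> z, \<tau> z)"]) (auto simp: co(1))
  qed
qed

text \<open>Translates the weak derivative into coordinates adapted to the direction
  \<open>e\<close>. A product of profiles vanishing off the closed rectangle is an admissible test
  function, because the rectangle is a compact subset of \<open>X\<close>.\<close>

lemma weak_partial_rectangle_identity:
  assumes fr: "axis_frame e \<iota> \<sigma> \<tau>" and X: "open X" "continuous_on X h" and wp: "weak_partial X e h g"
    and sg: "set_borel_measurable lebesgue X g"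
    and g': "g' \<in> borel_measurable borel" "integrable lborel g'" "AE z in lborel. indicator X z *\<^sub>R g z = g' z"
    and st: "s1 < s2" "t1 < t2" and R: "\<iota> ` ({s1..s2} \<times> {t1..t2}) \<subseteq> X"
  shows "(LBINT s:{s1<..<s2}. h (\<iota> (s, t2)) - h (\<iota> (s, t1))) = (LBINT p:{s1<..<s2} \<times> {t1<..<t2}. g' (\<iota> p))"
proof (rule rectangle_identity[OF st])
  note co = axis_frame_coordinates[OF fr]
  let ?R = "{s1..s2} \<times> {t1..t2}"
  let ?RR = "\<iota> ` ?R"
  note RR = axis_rectangle[OF fr, where c = s1 and d = s2 and a = t1 and b = t2]
  show "continuous_on ?R (\<lambda>p. h (\<iota> p))"
    by (rule continuous_on_compose2[OF X(2) co(4)]) (use R in auto)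
  have "integrable (distr lborel borel \<iota>) g'"
    by (rule subst[OF co(8), where P = "\<lambda>M. integrable M g'"]) (rule g'(2))
  then show "integrable lborel (\<lambda>p. g' (\<iota> p))"
    using co(7) by (intro integrable_distr[of \<iota> lborel borel g']) auto
  fix A A' B
  assume A: "smooth_real A" "\<And>x. (A has_real_derivative A' x) (at x)" and B: "smooth_real B"
    and A0: "\<And>t. t \<notin> {t1..t2} \<Longrightarrow> A t = 0" and B0: "\<And>s. s \<notin> {s1..s2} \<Longrightarrow> B s = 0"
  \<comment> \<open>Off the rectangle not only the test function but also its derivative vanishes,
    so \<open>h\<close> may be cut off there and the integral over \<open>X\<close> becomes one over
    the rectangle.\<close>
  have A'0: "A' t = 0" if "t \<notin> {t1..t2}" for t
  proof -
    have "(A has_real_derivative 0) (at t)"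
      by (rule has_field_derivative_transform_within_open[of "\<lambda>x. 0" _ _ "- {t1..t2}"]) (use that A0 in auto)
    then show ?thesis using A(2) DERIV_unique by blast
  qed
  define \<phi> where "\<phi> z = B (\<sigma> z) * A (\<tau> z)" for z
  define D where "D z = B (\<sigma> z) * A' (\<tau> z)" for z
  have \<phi>: "smooth_fun \<phi>" "frechet_derivative \<phi> (at z) e = D z" for z
    unfolding \<phi>_def D_def by (rule axis_frame_tensor[OF fr A B])+
  have z0: "\<phi> z = 0" "D z = 0" if "z \<notin> ?RR" for z
    using that A0 A'0 B0 unfolding RR(2) \<phi>_def D_def by auto
  have "closure {z. \<phi> z \<noteq> 0} \<subseteq> ?RR"
    using z0(1) RR(1) by (intro closure_minimal compact_imp_closed) auto
  moreover from this have "compact (closure {z. \<phi> z \<noteq> 0})"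
    using compact_Int_closed[OF RR(1), of "closure {z. \<phi> z \<noteq> 0}"] by (simp add: inf.absorb2)
  ultimately have tf: "test_function X \<phi>"
    unfolding test_function_def using \<phi>(1) R by blast
  have cont: "continuous_on UNIV A'" "continuous_on UNIV A" "continuous_on UNIV B"
    by (intro smooth_real_continuous smooth_real_derivative[OF A] A B)+
  have m: "(\<lambda>z. f (\<rho> z)) \<in> borel_measurable borel" if "continuous_on UNIV f" "continuous_on UNIV \<rho>"
    for f :: "real \<Rightarrow> real" and \<rho> :: "complex \<Rightarrow> real"
    by (rule borel_measurable_continuous_onI, rule continuous_on_compose2[OF that]) auto
  have \<phi>m: "\<phi> \<in> borel_measurable borel" and Dm: "D \<in> borel_measurable borel"
    unfolding \<phi>_def[abs_def] D_def[abs_def] by (intro borel_measurable_times m cont co)+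
  have hm: "(\<lambda>z. indicator ?RR z *\<^sub>R h z) \<in> borel_measurable borel"
    using RR(1) R X(2) by (intro borel_measurable_continuous_on_indicator borel_compact) (auto intro: continuous_on_subset)
  have DH: "(\<lambda>z. D z *\<^sub>R indicator ?RR z *\<^sub>R h z) \<in> borel_measurable borel"
    by (rule borel_measurable_scaleR[OF Dm hm])
  have eq: "(LINT z:X|lebesgue. D z *\<^sub>R h z) = - (LINT z:X|lebesgue. \<phi> z *\<^sub>R g z)"
  proof -
    have "(LINT z:X|lebesgue. frechet_derivative \<phi> (at z) e *\<^sub>R h z) = - (LINT z:X|lebesgue. \<phi> z *\<^sub>R g z)"
      using wp tf unfolding weak_partial_def by blast
    then show ?thesis unfolding \<phi>(2) .
  qed
  have "(LINT z:X|lebesgue. D z *\<^sub>R h z) = (\<integral>z. D z *\<^sub>R indicator ?RR z *\<^sub>R h z \<partial>lebesgue)"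
    unfolding set_lebesgue_integral_def
  proof (rule Bochner_Integration.integral_cong[OF refl])
    fix z show "indicator X z *\<^sub>R D z *\<^sub>R h z = D z *\<^sub>R indicator ?RR z *\<^sub>R h z"
      using R z0(2)[of z] by (cases "z \<in> ?RR") auto
  qed
  also have "\<dots> = (\<integral>z. D z *\<^sub>R indicator ?RR z *\<^sub>R h z \<partial>lborel)"
    by (rule integral_completion) (use DH in \<open>simp del: scaleR_scaleR\<close>)
  also have "\<dots> = (\<integral>p. D (\<iota> p) *\<^sub>R indicator ?RR (\<iota> p) *\<^sub>R h (\<iota> p) \<partial>lborel)"
    by (subst co(8), rule integral_distr) (use co(7) DH in \<open>simp_all del: scaleR_scaleR\<close>)
  also have "\<dots> = (\<integral>p. (B (fst p) * A' (snd p)) *\<^sub>R indicator ?R p *\<^sub>R h (\<iota> p) \<partial>lborel)"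
  proof (rule Bochner_Integration.integral_cong[OF refl])
    fix p
    have "\<iota> p \<in> ?RR \<longleftrightarrow> p \<in> ?R" unfolding RR(2) co(2,3) by (cases p) auto
    then show "D (\<iota> p) *\<^sub>R indicator ?RR (\<iota> p) *\<^sub>R h (\<iota> p) = (B (fst p) * A' (snd p)) *\<^sub>R indicator ?R p *\<^sub>R h (\<iota> p)"
      by (simp add: D_def co indicator_def)
  qed
  finally have l: "(LINT z:X|lebesgue. D z *\<^sub>R h z) = (\<integral>p. (B (fst p) * A' (snd p)) *\<^sub>R indicator ?R p *\<^sub>R h (\<iota> p) \<partial>lborel)" .
  have gm: "(\<lambda>z. indicator X z *\<^sub>R g z) \<in> borel_measurable lebesgue"
    using sg by (simp add: set_borel_measurable_def)
  have "(LINT z:X|lebesgue. \<phi> z *\<^sub>R g z) = (\<integral>z. \<phi> z *\<^sub>R (indicator X z *\<^sub>R g z) \<partial>lebesgue)"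
    unfolding set_lebesgue_integral_def by (simp add: mult.commute)
  also have "\<dots> = (\<integral>z. \<phi> z *\<^sub>R g' z \<partial>lebesgue)"
  proof (rule integral_cong_AE)
    show "AE z in lebesgue. \<phi> z *\<^sub>R (indicator X z *\<^sub>R g z) = \<phi> z *\<^sub>R g' z"
      using g'(3) unfolding AE_completion_iff by eventually_elim simp
    have "\<phi> \<in> borel_measurable lebesgue" "g' \<in> borel_measurable lebesgue"
      using \<phi>m g'(1) by (auto intro: measurable_completion)
    then show "(\<lambda>z. \<phi> z *\<^sub>R (indicator X z *\<^sub>R g z)) \<in> borel_measurable lebesgue"
      "(\<lambda>z. \<phi> z *\<^sub>R g' z) \<in> borel_measurable lebesgue"
      using gm by (simp_all del: scaleR_scaleR)
  qed
  also have "\<dots> = (\<integral>z. \<phi> z *\<^sub>R g' z \<partial>lborel)"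
    using \<phi>m g' by (intro integral_completion) simp
  also have "\<dots> = (\<integral>p. \<phi> (\<iota> p) *\<^sub>R g' (\<iota> p) \<partial>lborel)"
    by (subst co(8), rule integral_distr) (use co(7) \<phi>m g' in simp_all)
  finally show "(\<integral>p. (B (fst p) * A' (snd p)) *\<^sub>R indicator ?R p *\<^sub>R h (\<iota> p) \<partial>lborel) =
      - (\<integral>p. (B (fst p) * A (snd p)) *\<^sub>R g' (\<iota> p) \<partial>lborel)"
    using eq l by (simp add: \<phi>_def co)
qed

text \<open>Two consequences of absolute continuity on almost every line of a rectangle: the image
  curve is rectifiable, hence null, and the classical derivative along the line is the weak
  one.\<close>

lemma weak_partial_lines:
  assumes fr: "axis_frame e \<iota> \<sigma> \<tau>" and X: "open X" "bounded X" "continuous_on X h"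
    and wp: "weak_partial X e h g" and g: "L2_on X g"
    and cd: "c < d" and R: "\<iota> ` ({c..d} \<times> {a..b}) \<subseteq> X"
  shows "AE s in lborel. s \<in> {c<..<d} \<longrightarrow> negligible ((\<lambda>t. h (\<iota> (s, t))) ` {a..b})"
    "AE p in lborel. p \<in> {c<..<d} \<times> {a<..<b} \<longrightarrow>
       ((\<lambda>u. h (\<iota> (fst p, u))) has_vector_derivative g (\<iota> p)) (at (snd p))"
proof -
  note co = axis_frame_coordinates[OF fr]
  obtain g' where g': "g' \<in> borel_measurable borel" "integrable lborel g'" "AE z in lborel. indicator X z *\<^sub>R g z = g' z"
    using L2_on_borel_representative[OF X(2,1) g] .
  define H G where "H p = h (\<iota> p)" and "G p = g' (\<iota> p)" for p
  have H: "continuous_on ({c..d} \<times> {a..b}) H"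
    unfolding H_def by (rule continuous_on_compose2[OF X(3) co(4)]) (use R in auto)
  have "integrable (distr lborel borel \<iota>) g'"
    by (rule subst[OF co(8), where P = "\<lambda>M. integrable M g'"]) (rule g'(2))
  then have G: "integrable lborel G"
    unfolding G_def[abs_def] using co(7) by (intro integrable_distr[of \<iota> lborel borel g']) auto
  have Hs: "continuous_on {a..b} (\<lambda>t. H (s, t))" if "s \<in> {c..d}" for s
    using that by (intro continuous_on_compose2[OF H] continuous_intros) auto
  have ac: "AE s in lborel. s \<in> {c<..<d} \<longrightarrow> integrable lborel (\<lambda>t. G (s, t)) \<and>
     (\<forall>t1\<in>{a..b}. \<forall>t2\<in>{a..b}. t1 \<le> t2 \<longrightarrow> H (s, t2) - H (s, t1) = (LBINT t:{t1<..<t2}. G (s, t)))"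
  proof (rule absolutely_continuous_on_lines[OF cd H G])
    fix s1 s2 t1 t2 assume *: "c \<le> s1" "s1 < s2" "s2 \<le> d" "a \<le> t1" "t1 < t2" "t2 \<le> b"
    have "\<iota> ` ({s1..s2} \<times> {t1..t2}) \<subseteq> \<iota> ` ({c..d} \<times> {a..b})" using * by (intro image_mono) auto
    then show "(LBINT s:{s1<..<s2}. H (s, t2) - H (s, t1)) = (LBINT p:{s1<..<s2} \<times> {t1<..<t2}. G p)"
      unfolding H_def G_def using * R
      using g by (intro weak_partial_rectangle_identity[OF fr X(1,3) wp _ g']) (auto simp: L2_on_def)
  qed
  show "AE s in lborel. s \<in> {c<..<d} \<longrightarrow> negligible ((\<lambda>t. h (\<iota> (s, t))) ` {a..b})"
    using ac
  proof eventually_elim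
    case (elim s)
    then show ?case
      using negligible_image_of_indefinite_integral[of a b "\<lambda>t. H (s, t)" "\<lambda>t. G (s, t)"] Hs[of s]
      by (auto simp: H_def)
  qed
  have "AE p in lborel. p \<in> {c<..<d} \<times> {a<..<b} \<longrightarrow>
       ((\<lambda>u. H (fst p, u)) has_vector_derivative G p) (at (snd p))"
  proof (rule partial_derivative_ae[OF H G])
    show "AE s in lborel. s \<in> {c<..<d} \<longrightarrow> (AE t in lborel. t \<in> {a<..<b} \<longrightarrow>
       ((\<lambda>u. H (s, u)) has_vector_derivative G (s, t)) (at t))"
      using ac
    proof eventually_elim
      case (elim s)
      then show ?case
        using derivative_ae_of_indefinite_integral[of "\<lambda>t. G (s, t)" a b "\<lambda>t. H (s, t)"] by blast
    qed
  qed
  \<comment> \<open>So far the derivative is the Borel representative \<open>g'\<close>. The two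
    agree almost everywhere, which brings back the given weak derivative \<open>g\<close>.\<close>
  moreover have "AE p in lborel. indicator X (\<iota> p) *\<^sub>R g (\<iota> p) = g' (\<iota> p)"
  proof (rule AE_distrD[of \<iota> lborel borel])
    show "AE z in distr lborel borel \<iota>. indicator X z *\<^sub>R g z = g' z"
      by (rule subst[OF co(8), where P = "\<lambda>M. AE z in M. indicator X z *\<^sub>R g z = g' z"]) (rule g'(3))
  qed (use co(7) in auto)
  ultimately show "AE p in lborel. p \<in> {c<..<d} \<times> {a<..<b} \<longrightarrow>
       ((\<lambda>u. h (\<iota> (fst p, u))) has_vector_derivative g (\<iota> p)) (at (snd p))"
  proof eventually_elim
    case (elim p)
    show ?case
    proof
      assume p: "p \<in> {c<..<d} \<times> {a<..<b}"
      then have "\<iota> p \<in> X" using R by force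
      then show "((\<lambda>u. h (\<iota> (fst p, u))) has_vector_derivative g (\<iota> p)) (at (snd p))"
        using elim p by (simp add: H_def G_def)
    qed
  qed
qed

section \<open>From rectangles to the whole domain\<close>

lemma open_contains_rat_interval:
  assumes "open S" "(s::real) \<in> S"
  obtains c d :: rat where "of_rat c < s" "s < of_rat d" "{of_rat c..of_rat d} \<subseteq> S"
proof -
  obtain e where e: "e > 0" "cball s e \<subseteq> S" using assms open_contains_cball by blast
  obtain c :: rat where c: "s - e < of_rat c" "of_rat c < s"
    using of_rat_dense[of "s - e" s] e by auto
  obtain d :: rat where d: "s < of_rat d" "of_rat d < s + e"
    using of_rat_dense[of s "s + e"] e by auto
  have "{of_rat c..of_rat d} \<subseteq> cball s e" using c d by (auto simp: dist_real_def)
  then show thesis using that c d e by blast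
qed

lemma open_contains_rat_rectangle:
  assumes "open V" "(s::real, t::real) \<in> V"
  obtains c d a b :: rat where "of_rat c < s" "s < of_rat d" "of_rat a < t" "t < of_rat b"
    "{of_rat c..of_rat d} \<times> {of_rat a..of_rat b} \<subseteq> V"
proof -
  obtain S T where ST: "open S" "open T" "(s,t) \<in> S \<times> T" "S \<times> T \<subseteq> V"
    using open_prod_elim[OF assms] by blast
  obtain c d where "of_rat c < s" "s < of_rat d" "{of_rat c..of_rat d} \<subseteq> S"
    using open_contains_rat_interval[OF ST(1)] ST(3) by blast
  moreover obtain a b where "of_rat a < t" "t < of_rat b" "{of_rat a..of_rat b} \<subseteq> T"
    using open_contains_rat_interval[OF ST(2)] ST(3) by blast
  ultimately show thesis using that[of c d a b] ST(4) by blast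
qed

text \<open>Countably many rectangles exhaust \<open>X\<close>, so the null sets found on the single
  rectangles can be united. The point lies strictly inside, as the results on rectangles exclude
  their edges.\<close>

lemma axis_frame_rat_rectangle:
  assumes fr: "axis_frame e \<iota> \<sigma> \<tau>" and "open X" "\<iota> (s, t) \<in> X"
  obtains c d a b :: rat where "of_rat c < s" "s < of_rat d" "of_rat a < t" "t < of_rat b"
    "\<iota> ` ({of_rat c..of_rat d} \<times> {of_rat a..of_rat b}) \<subseteq> X"
proof -
  have "open (\<iota> -` X)"
    using axis_frame_coordinates(4)[OF fr, of UNIV] assms(2) by (simp add: open_vimage)
  then show thesis
    using open_contains_rat_rectangle[of "\<iota> -` X" s t] assms(3) that by (metis image_subset_iff_subset_vimage vimageI)
qed

text \<open>For one rectangle, \<open>W\<close> collects the pairs (line, value attained on it).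
  Almost every line has a null set of values, so \<open>W\<close> is null, and Fubini in the other
  order says that almost every value occurs on almost no line. As a continuous image of a compact
  rectangle \<open>W\<close> is closed, hence measurable.\<close>

lemma fibres_avoid_almost_all_lines:
  assumes fr: "axis_frame e \<iota> \<sigma> \<tau>" and X: "open X" "bounded X" "continuous_on X h"
    and wp: "weak_partial X e h g" and g: "L2_on X g"
  shows "AE y in lborel. AE s in lborel. \<forall>t. \<iota> (s, t) \<in> X \<longrightarrow> h (\<iota> (s, t)) \<noteq> y"
proof -
  define W where "W c d a b = (\<lambda>p. (fst p, h (\<iota> p))) ` ({c..d} \<times> {a..b})" for c d a b :: real
  have one: "AE y in lborel. AE s in lborel. (s, y) \<notin> W c d a b"
    if cd: "c < d" and R: "\<iota> ` ({c..d} \<times> {a..b}) \<subseteq> X" for c d a b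
  proof -
    have "continuous_on ({c..d} \<times> {a..b}) (\<lambda>p. (fst p, h (\<iota> p)))"
      using R by (intro continuous_intros continuous_on_compose2[OF X(3)] axis_frame_coordinates(4)[OF fr]) auto
    then have "compact (W c d a b)"
      unfolding W_def by (intro compact_continuous_image compact_Times) auto
    then have Wb: "W c d a b \<in> sets (borel \<Otimes>\<^sub>M borel)"
      unfolding borel_prod by (rule borel_compact)
    \<comment> \<open>The closed rectangle contains the lines \<open>s = c\<close> and
      \<open>s = d\<close>, about which nothing is known; they are discarded as single
      points.\<close>
    have "AE s in lborel. AE y in lborel. (s, y) \<notin> W c d a b"
      using weak_partial_lines(1)[OF fr X wp g cd R] AE_lborel_singleton[of c] AE_lborel_singleton[of d]
    proof eventually_elim
      case (elim s)
      show ?case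
      proof (cases "s \<in> {c<..<d}")
        case True
        with elim have "AE y in lborel. y \<notin> (\<lambda>t. h (\<iota> (s, t))) ` {a..b}"
          by (intro negligible_imp_AE_lborel) blast
        then show ?thesis by (rule eventually_mono) (auto simp: W_def)
      next
        case False
        with elim show ?thesis by (auto simp: W_def)
      qed
    qed
    moreover have "{p \<in> space (lborel \<Otimes>\<^sub>M lborel). (fst p, snd p) \<notin> W c d a b} \<in> sets (lborel \<Otimes>\<^sub>M lborel)"
    proof -
      have "{p \<in> space (lborel \<Otimes>\<^sub>M lborel). (fst p, snd p) \<notin> W c d a b} = space (borel \<Otimes>\<^sub>M borel) - W c d a b"
        by (auto simp: space_pair_measure)
      then show ?thesis using Wb by (simp cong: sets_pair_measure_cong)
    qed
    ultimately show ?thesis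
      using lborel_pair.AE_commute[where P = "\<lambda>s y. (s, y) \<notin> W c d a b"] by simp
  qed
  let ?ok = "\<lambda>(c,d,a,b). (of_rat c :: real) < of_rat d \<and> \<iota> ` ({of_rat c..of_rat d} \<times> {of_rat a..of_rat b}) \<subseteq> X"
  have "AE y in lborel. \<forall>q. ?ok q \<longrightarrow> (AE s in lborel. (s, y) \<notin> (case q of (c,d,a,b) \<Rightarrow> W (of_rat c) (of_rat d) (of_rat a) (of_rat b)))"
    unfolding AE_all_countable
  proof
    fix q :: "rat \<times> rat \<times> rat \<times> rat"
    obtain c d a b where q: "q = (c,d,a,b)" by (cases q)
    show "AE y in lborel. ?ok q \<longrightarrow> (AE s in lborel. (s, y) \<notin> (case q of (c,d,a,b) \<Rightarrow> W (of_rat c) (of_rat d) (of_rat a) (of_rat b)))"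
      using one[of "of_rat c" "of_rat d" "of_rat a" "of_rat b"] by (cases "?ok q") (auto simp: q)
  qed
  then show ?thesis
  proof eventually_elim
    case (elim y)
    \<comment> \<open>For the fixed value \<open>y\<close> the null sets of lines belonging to the
      rational rectangles are merged into one.\<close>
    then have "AE s in lborel. \<forall>q. ?ok q \<longrightarrow> (s, y) \<notin> (case q of (c,d,a,b) \<Rightarrow> W (of_rat c) (of_rat d) (of_rat a) (of_rat b))"
      unfolding AE_all_countable by (simp add: AE_impI)
    then show ?case
    proof eventually_elim
      case (elim s)
      show ?case
      proof (intro allI impI notI)
        fix t assume X': "\<iota> (s, t) \<in> X" and y: "h (\<iota> (s, t)) = y"
        obtain c d a b :: rat where r: "of_rat c < s" "s < of_rat d" "of_rat a < t" "t < of_rat b"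
          "\<iota> ` ({of_rat c..of_rat d} \<times> {of_rat a..of_rat b}) \<subseteq> X"
          using axis_frame_rat_rectangle[OF fr X(1) X'] .
        then have "(s, y) \<notin> W (of_rat c) (of_rat d) (of_rat a) (of_rat b)"
          using elim[rule_format, of "(c,d,a,b)"] by auto
        moreover have "(s, y) \<in> W (of_rat c) (of_rat d) (of_rat a) (of_rat b)"
          unfolding W_def using r y by (intro image_eqI[of _ _ "(s,t)"]) auto
        ultimately show False by contradiction
      qed
    qed
  qed
qed

text \<open>The rational rectangles give the claim almost everywhere in coordinates; the inverse
  coordinate map carries it back to the complex plane.\<close>

lemma weak_partial_is_partial_ae:
  assumes fr: "axis_frame e \<iota> \<sigma> \<tau>" and X: "open X" "bounded X" "continuous_on X h"
    and wp: "weak_partial X e h g" and g: "L2_on X g"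
  shows "AE z in lborel. z \<in> X \<longrightarrow> ((\<lambda>u. h (\<iota> (\<sigma> z, u))) has_vector_derivative g z) (at (\<tau> z))"
proof -
  note co = axis_frame_coordinates[OF fr]
  let ?P = "\<lambda>p. ((\<lambda>u. h (\<iota> (fst p, u))) has_vector_derivative g (\<iota> p)) (at (snd p))"
  let ?ok = "\<lambda>(c,d,a,b). (of_rat c :: real) < of_rat d \<and> \<iota> ` ({of_rat c..of_rat d} \<times> {of_rat a..of_rat b}) \<subseteq> X"
  have "AE p in lborel. \<forall>q. ?ok q \<longrightarrow> p \<in> (case q of (c,d,a,b) \<Rightarrow> {of_rat c<..<of_rat d} \<times> {of_rat a<..<of_rat b}) \<longrightarrow> ?P p"
    unfolding AE_all_countable
  proof
    fix q :: "rat \<times> rat \<times> rat \<times> rat"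
    obtain c d a b where q: "q = (c,d,a,b)" by (cases q)
    show "AE p in lborel. ?ok q \<longrightarrow> p \<in> (case q of (c,d,a,b) \<Rightarrow> {of_rat c<..<of_rat d} \<times> {of_rat a<..<of_rat b}) \<longrightarrow> ?P p"
      using weak_partial_lines(2)[OF fr X wp g, of "of_rat c" "of_rat d" "of_rat a" "of_rat b"]
      by (cases "?ok q") (auto simp: q)
  qed
  then have ae: "AE p in lborel. \<iota> p \<in> X \<longrightarrow> ?P p"
  proof eventually_elim
    case (elim p)
    show ?case
    proof
      assume "\<iota> p \<in> X"
      then have "\<iota> (fst p, snd p) \<in> X" by simp
      then obtain c d a b :: rat where r: "of_rat c < fst p" "fst p < of_rat d" "of_rat a < snd p" "snd p < of_rat b"
          "\<iota> ` ({of_rat c..of_rat d} \<times> {of_rat a..of_rat b}) \<subseteq> X"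
        using axis_frame_rat_rectangle[OF fr X(1)] by blast
      have cd: "(of_rat c :: real) < of_rat d" using r by linarith
      have "p \<in> {of_rat c<..<of_rat d} \<times> {of_rat a<..<of_rat b}" using r by (cases p) auto
      with cd r(5) show "?P p" using elim[rule_format, of "(c,d,a,b)"] by blast
    qed
  qed
  \<comment> \<open>The inverse of \<open>\<iota>\<close>. Since \<open>\<iota>\<close> carries
    Lebesgue measure to Lebesgue measure, so does its inverse.\<close>
  let ?\<kappa> = "\<lambda>z. (\<sigma> z, \<tau> z)"
  have \<kappa>m: "?\<kappa> \<in> borel_measurable borel"
    by (intro borel_measurable_continuous_onI continuous_on_Pair co)
  have "distr lborel borel ?\<kappa> = distr (distr lborel borel \<iota>) borel ?\<kappa>"
    by (rule arg_cong[OF co(8)])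
  also have "\<dots> = distr lborel borel (?\<kappa> \<circ> \<iota>)"
    using co(7) \<kappa>m by (intro distr_distr) auto
  also have "\<dots> = lborel"
    by (simp add: o_def co distr_id2)
  finally have "AE p in distr lborel borel ?\<kappa>. \<iota> p \<in> X \<longrightarrow> ?P p"
    by (rule ssubst) (rule ae)
  then have "AE z in lborel. \<iota> (?\<kappa> z) \<in> X \<longrightarrow> ?P (?\<kappa> z)"
    by (rule AE_distrD[rotated]) (use \<kappa>m in simp)
  then show ?thesis by (simp add: co)
qed

section \<open>Preimages of null sets\<close>

lemma AE_lborel_imp_negligible: "AE x in lborel. P x \<Longrightarrow> negligible {x. \<not> P x}"
  using AE_completion[of P lborel]
  by (auto simp: eventually_ae_filter negligible_iff_null_sets intro: negligible_subset
      simp flip: negligible_iff_null_sets)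

lemma rational_complex_dense:
  assumes "e > 0"
  obtains q1 q2 :: rat where "cmod (Complex (of_rat q1) (of_rat q2) - z) < e"
proof -
  obtain q1 :: rat where q1: "Re z < of_rat q1" "of_rat q1 < Re z + e / 2"
    using of_rat_dense[of "Re z" "Re z + e / 2"] assms by auto
  obtain q2 :: rat where q2: "Im z < of_rat q2" "of_rat q2 < Im z + e / 2"
    using of_rat_dense[of "Im z" "Im z + e / 2"] assms by auto
  have "cmod (Complex (of_rat q1) (of_rat q2) - z) \<le> \<bar>of_rat q1 - Re z\<bar> + \<bar>of_rat q2 - Im z\<bar>"
    using cmod_le[of "Complex (of_rat q1) (of_rat q2) - z"] by simp
  also have "\<dots> < e" using q1 q2 by linarith
  finally show thesis by (rule that)
qed

text \<open>Cramer's rule: \<open>a * D\<close> and \<open>b * D\<close> are determinants formed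
  from the image vector \<open>v\<close> and one of the columns, hence at most \<open>cmod v\<close>
  times entries of the matrix. This gives the explicit constant \<open>D / M\<close>.\<close>

lemma linear_lower_bound_of_positive_det:
  assumes "Re w1 * Im w2 - Re w2 * Im w1 > 0"
  obtains c where "c > 0" "\<And>a b. cmod (a *\<^sub>R w1 + b *\<^sub>R w2) \<ge> c * (\<bar>a\<bar> + \<bar>b\<bar>)"
proof -
  define D where "D = Re w1 * Im w2 - Re w2 * Im w1"
  define M where "M = \<bar>Re w1\<bar> + \<bar>Im w1\<bar> + \<bar>Re w2\<bar> + \<bar>Im w2\<bar>"
  have D: "D > 0" using assms by (simp add: D_def)
  have M: "M > 0"
  proof (rule ccontr)
    assume "\<not> M > 0"
    then have "Re w1 = 0" "Re w2 = 0" unfolding M_def by linarith+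
    then show False using D by (simp add: D_def)
  qed
  show thesis
  proof (rule that[of "D / M"])
    show "D / M > 0" using D M by simp
    fix a b
    define v where "v = a *\<^sub>R w1 + b *\<^sub>R w2"
    have ab: "a * D = Re v * Im w2 - Im v * Re w2" "b * D = Re w1 * Im v - Im w1 * Re v"
      by (simp_all add: v_def D_def algebra_simps)
    have av: "\<bar>Re v * Im w2 - Im v * Re w2\<bar> \<le> cmod v * (\<bar>Im w2\<bar> + \<bar>Re w2\<bar>)"
    proof -
      have "\<bar>Re v * Im w2 - Im v * Re w2\<bar> \<le> \<bar>Re v\<bar> * \<bar>Im w2\<bar> + \<bar>Im v\<bar> * \<bar>Re w2\<bar>"
        by (simp flip: abs_mult)
      also have "\<dots> \<le> cmod v * \<bar>Im w2\<bar> + cmod v * \<bar>Re w2\<bar>"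
        by (intro add_mono mult_right_mono abs_Re_le_cmod abs_Im_le_cmod) auto
      finally show ?thesis by (simp add: algebra_simps)
    qed
    have bv: "\<bar>Re w1 * Im v - Im w1 * Re v\<bar> \<le> cmod v * (\<bar>Im w1\<bar> + \<bar>Re w1\<bar>)"
    proof -
      have "\<bar>Re w1 * Im v - Im w1 * Re v\<bar> \<le> \<bar>Re w1\<bar> * \<bar>Im v\<bar> + \<bar>Im w1\<bar> * \<bar>Re v\<bar>"
        by (simp flip: abs_mult)
      also have "\<dots> \<le> \<bar>Re w1\<bar> * cmod v + \<bar>Im w1\<bar> * cmod v"
        by (intro add_mono mult_left_mono abs_Re_le_cmod abs_Im_le_cmod) auto
      finally show ?thesis by (simp add: algebra_simps)
    qed
    have "\<bar>a * D\<bar> + \<bar>b * D\<bar> \<le> cmod v * (\<bar>Im w2\<bar> + \<bar>Re w2\<bar>) + cmod v * (\<bar>Im w1\<bar> + \<bar>Re w1\<bar>)"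
      unfolding ab using av bv by (rule add_mono)
    also have "\<dots> = cmod v * M" by (simp add: M_def algebra_simps)
    finally have "\<bar>a * D\<bar> + \<bar>b * D\<bar> \<le> cmod v * M" .
    then have "D * (\<bar>a\<bar> + \<bar>b\<bar>) \<le> cmod v * M" using D by (simp add: abs_mult algebra_simps)
    then show "cmod (a *\<^sub>R w1 + b *\<^sub>R w2) \<ge> D / M * (\<bar>a\<bar> + \<bar>b\<bar>)"
      using M by (simp add: v_def pos_divide_le_eq)
  qed
qed

text \<open>The set is not assumed measurable: comparing two of its points through the corner
  \<open>Complex (Re z') (Im z)\<close> uses the horizontal increment at one point and the vertical increment
  at the other.\<close>
lemma negligible_preimage_piece:
  fixes h :: "complex \<Rightarrow> complex"
  assumes N: "negligible N" and c: "c > 0" and \<delta>: "\<delta> > 0"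
    and m: "\<And>a b. cmod (a *\<^sub>R m1 + b *\<^sub>R m2) \<ge> 2 * c * (\<bar>a\<bar> + \<bar>b\<bar>)"
    and E: "\<And>z. z \<in> E \<Longrightarrow> h z \<in> N" "\<And>z w. z \<in> E \<Longrightarrow> w \<in> E \<Longrightarrow> cmod (z - w) < \<delta>"
    and hor: "\<And>z u. z \<in> E \<Longrightarrow> \<bar>u - Re z\<bar> < \<delta> \<Longrightarrow>
        cmod (h (Complex u (Im z)) - h z - (u - Re z) *\<^sub>R m1) \<le> c * \<bar>u - Re z\<bar>"
    and ver: "\<And>z u. z \<in> E \<Longrightarrow> \<bar>u - Im z\<bar> < \<delta> \<Longrightarrow>
        cmod (h (Complex (Re z) u) - h z - (u - Im z) *\<^sub>R m2) \<le> c * \<bar>u - Im z\<bar>"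
  shows "negligible E"
proof -
  have low: "c * cmod (z' - z) \<le> cmod (h z' - h z)" if z: "z \<in> E" "z' \<in> E" for z z'
  proof -
    have d: "\<bar>Re z' - Re z\<bar> < \<delta>" "\<bar>Im z - Im z'\<bar> < \<delta>"
      using E(2)[OF z(2,1)] E(2)[OF z] abs_Re_le_cmod[of "z' - z"] abs_Im_le_cmod[of "z - z'"] by auto
    define a b where "a = Re z' - Re z" and "b = Im z' - Im z"
    \<comment> \<open>Both errors refer to the same corner, so its value cancels in
      \<open>h2 - h1\<close>. The linear part is at least \<open>2 * c\<close> times the increment,
      the errors consume at most \<open>c\<close> times it, and \<open>c\<close> remains as the
      lower Lipschitz constant.\<close>
    define h1 where "h1 = h (Complex (Re z') (Im z)) - h z - a *\<^sub>R m1"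
    define h2 where "h2 = h (Complex (Re z') (Im z)) - h z' - (- b) *\<^sub>R m2"
    have h1: "cmod h1 \<le> c * \<bar>a\<bar>" using hor[OF z(1) d(1)] by (simp add: h1_def a_def)
    have h2: "cmod h2 \<le> c * \<bar>b\<bar>" using ver[OF z(2) d(2)] by (simp add: h2_def b_def abs_minus_commute)
    have "a *\<^sub>R m1 + b *\<^sub>R m2 = (h z' - h z) + (h2 - h1)" by (simp add: h1_def h2_def)
    then have "2 * c * (\<bar>a\<bar> + \<bar>b\<bar>) \<le> cmod ((h z' - h z) + (h2 - h1))" using m[of a b] by simp
    also have "\<dots> \<le> cmod (h z' - h z) + (cmod h2 + cmod h1)"
      by (intro order_trans[OF norm_triangle_ineq] add_left_mono norm_triangle_ineq4)
    finally have "c * (\<bar>a\<bar> + \<bar>b\<bar>) \<le> cmod (h z' - h z)"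
      using h1 h2 by (simp add: algebra_simps)
    moreover have "c * cmod (z' - z) \<le> c * (\<bar>a\<bar> + \<bar>b\<bar>)"
      using c cmod_le[of "z' - z"] by (intro mult_left_mono) (auto simp: a_def b_def)
    ultimately show ?thesis by linarith
  qed
  have inj: "inj_on h E"
  proof (rule inj_onI)
    fix z w assume "z \<in> E" "w \<in> E" "h z = h w"
    with low[of z w] have "c * cmod (w - z) \<le> 0" by simp
    then show "z = w" using c by (simp add: mult_le_0_iff)
  qed
  have "negligible (h ` E)" using N E(1) by (auto intro: negligible_subset)
  \<comment> \<open>\<open>E\<close> is recovered from the null set of its values by the inverse of
    \<open>h\<close> on \<open>E\<close>, which is Lipschitz with constant \<open>1 / c\<close>;
    Lipschitz maps in equal dimensions preserve null sets.\<close>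
  then have "negligible (inv_into E h ` (h ` E))"
  proof (rule negligible_locally_Lipschitz_image[OF order_refl])
    fix x assume "x \<in> h ` E"
    then obtain z where z: "z \<in> E" "x = h z" by blast
    have "norm (inv_into E h y - inv_into E h x) \<le> (1 / c) * norm (y - x)" if yE: "y \<in> h ` E" for y
    proof -
      obtain w where w: "w \<in> E" "y = h w" using yE by blast
      have "c * cmod (w - z) \<le> cmod (h w - h z)" using low z w by blast
      then show ?thesis using z w inj c by (simp add: inv_into_f_f field_simps)
    qed
    then show "\<exists>T B. open T \<and> x \<in> T \<and> (\<forall>y\<in>h ` E \<inter> T. norm (inv_into E h y - inv_into E h x) \<le> B * norm (y - x))"
      by (intro exI[of _ UNIV] exI[of _ "1 / c"]) auto
  qed
  moreover have "inv_into E h ` (h ` E) = E"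
    using inj by (simp add: image_image inv_into_f_f cong: image_cong)
  ultimately show ?thesis by simp
qed

text \<open>One half of the tolerance \<open>c\<close> pays for the definition of the derivative,
  the other half for replacing \<open>w\<close> by the approximation \<open>m\<close>.\<close>

lemma vector_derivative_increment:
  fixes \<gamma> :: "real \<Rightarrow> complex"
  assumes "(\<gamma> has_vector_derivative w) (at t)" "c > 0" "cmod (m - w) \<le> c / 2"
  obtains \<delta> where "\<delta> > 0" "\<And>u. \<bar>u - t\<bar> < \<delta> \<Longrightarrow> cmod (\<gamma> u - \<gamma> t - (u - t) *\<^sub>R m) \<le> c * \<bar>u - t\<bar>"
proof -
  have "c / 2 > 0" using assms by simp
  then obtain \<delta> where \<delta>: "\<delta> > 0"
    "\<And>u. norm (u - t) < \<delta> \<Longrightarrow> norm (\<gamma> u - \<gamma> t - (u - t) *\<^sub>R w) \<le> c / 2 * norm (u - t)"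
    using assms(1) unfolding has_vector_derivative_def has_derivative_at_alt by blast
  show thesis
  proof (rule that[OF \<delta>(1)])
    fix u assume u: "\<bar>u - t\<bar> < \<delta>"
    have "\<gamma> u - \<gamma> t - (u - t) *\<^sub>R m = (\<gamma> u - \<gamma> t - (u - t) *\<^sub>R w) - (u - t) *\<^sub>R (m - w)"
      by (simp add: algebra_simps)
    then have "cmod (\<gamma> u - \<gamma> t - (u - t) *\<^sub>R m) \<le> cmod (\<gamma> u - \<gamma> t - (u - t) *\<^sub>R w) + cmod ((u - t) *\<^sub>R (m - w))"
      by (metis norm_triangle_ineq4)
    also have "\<dots> \<le> c / 2 * \<bar>u - t\<bar> + \<bar>u - t\<bar> * (c / 2)"
      using \<delta>(2)[of u] u mult_left_mono[OF assms(3), of "\<bar>u - t\<bar>"] by (intro add_mono) simp_all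
    finally show "cmod (\<gamma> u - \<gamma> t - (u - t) *\<^sub>R m) \<le> c * \<bar>u - t\<bar>" by simp
  qed
qed

text \<open>Existence of the two partial derivatives does not provide total differentiability, so
  the cutting into pieces uses horizontal and vertical increments only. Each piece is null by the
  inverse Lipschitz estimate.\<close>

lemma negligible_preimage:
  fixes h g1 g2 :: "complex \<Rightarrow> complex"
  assumes N: "negligible N"
    and d1: "AE z in lborel. z \<in> X \<longrightarrow> ((\<lambda>u. h (Complex u (Im z))) has_vector_derivative g1 z) (at (Re z))"
    and d2: "AE z in lborel. z \<in> X \<longrightarrow> ((\<lambda>u. h (Complex (Re z) u)) has_vector_derivative g2 z) (at (Im z))"
    and J: "AE z in lborel. z \<in> X \<longrightarrow> jacobian g1 g2 z > 0"
  shows "negligible {z \<in> X. h z \<in> N}"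
proof -
  define good where "good z \<longleftrightarrow> ((\<lambda>u. h (Complex u (Im z))) has_vector_derivative g1 z) (at (Re z)) \<and>
     ((\<lambda>u. h (Complex (Re z) u)) has_vector_derivative g2 z) (at (Im z)) \<and> jacobian g1 g2 z > 0" for z
  have "AE z in lborel. z \<in> X \<longrightarrow> good z"
    using d1 d2 J by eventually_elim (auto simp: good_def)
  then have nB: "negligible {z. \<not> (z \<in> X \<longrightarrow> good z)}" (is "negligible ?B")
    by (rule AE_lborel_imp_negligible)
  define C where "C p q = Complex (of_rat p) (of_rat q)" for p q
  \<comment> \<open>The index \<open>n\<close> fixes the Lipschitz constant and \<open>k\<close> the
    scale; the first two rational points approximate the partial derivatives, and the third is the
    centre of a ball that makes the diameter of the piece smaller than the scale.\<close>
  define E where "E = (\<lambda>(n::nat, k::nat, p1, q1, p2, q2, p3, q3).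
     {z. h z \<in> N \<and> cmod (z - C p3 q3) < 1 / (2 * (real k + 1)) \<and>
       (\<forall>a b. cmod (a *\<^sub>R C p1 q1 + b *\<^sub>R C p2 q2) \<ge> 2 * (1 / (real n + 1)) * (\<bar>a\<bar> + \<bar>b\<bar>)) \<and>
       (\<forall>u. \<bar>u - Re z\<bar> < 1 / (real k + 1) \<longrightarrow>
          cmod (h (Complex u (Im z)) - h z - (u - Re z) *\<^sub>R C p1 q1) \<le> 1 / (real n + 1) * \<bar>u - Re z\<bar>) \<and>
       (\<forall>u. \<bar>u - Im z\<bar> < 1 / (real k + 1) \<longrightarrow>
          cmod (h (Complex (Re z) u) - h z - (u - Im z) *\<^sub>R C p2 q2) \<le> 1 / (real n + 1) * \<bar>u - Im z\<bar>)})"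
  have nE: "negligible (E i)" for i
  proof -
    obtain n k p1 q1 p2 q2 p3 q3 where i: "i = (n, k, p1, q1, p2, q2, p3, q3)" by (cases i) auto
    show ?thesis
    \<comment> \<open>The lower bound for the approximating matrix does not involve the point, so
      any single element of the piece provides it.\<close>
    proof (cases "E i = {}")
      case False
      then have m: "cmod (a *\<^sub>R C p1 q1 + b *\<^sub>R C p2 q2) \<ge> 2 * (1 / (real n + 1)) * (\<bar>a\<bar> + \<bar>b\<bar>)" for a b
        by (auto simp: E_def i)
      show ?thesis
      proof (rule negligible_preimage_piece[OF N _ _ m])
        show "1 / (real n + 1) > 0" "1 / (real k + 1) > 0" by simp_all
        fix z assume z: "z \<in> E i"
        then show "h z \<in> N" by (simp add: E_def i)
        fix w assume "w \<in> E i"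
        with z have "cmod (z - C p3 q3) < 1 / (2 * (real k + 1))" "cmod (w - C p3 q3) < 1 / (2 * (real k + 1))"
          by (simp_all add: E_def i)
        moreover have "cmod (z - w) \<le> cmod (z - C p3 q3) + cmod (w - C p3 q3)"
          using norm_triangle_ineq4[of "z - C p3 q3" "w - C p3 q3"] by simp
        moreover have "1 / (real k + 1) = 1 / (2 * (real k + 1)) + 1 / (2 * (real k + 1))"
          by (simp add: field_simps)
        ultimately show "cmod (z - w) < 1 / (real k + 1)"
          using add_strict_mono le_less_trans by metis
      qed (simp_all add: E_def i)
    qed simp
  qed
  have "{z \<in> X. h z \<in> N} \<subseteq> ?B \<union> (\<Union>i. E i)"
  proof
    fix z assume "z \<in> {z \<in> X. h z \<in> N}"
    then have z: "z \<in> X" "h z \<in> N" by auto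
    show "z \<in> ?B \<union> (\<Union>i. E i)"
    proof (cases "z \<in> ?B")
      case False
      with z have "good z" by auto
      then have g1: "((\<lambda>u. h (Complex u (Im z))) has_vector_derivative g1 z) (at (Re z))"
        and g2: "((\<lambda>u. h (Complex (Re z) u)) has_vector_derivative g2 z) (at (Im z))"
        and "Re (g1 z) * Im (g2 z) - Re (g2 z) * Im (g1 z) > 0"
        by (auto simp: good_def jacobian_def)
      then obtain c0 where c0: "c0 > 0" "\<And>a b. cmod (a *\<^sub>R g1 z + b *\<^sub>R g2 z) \<ge> c0 * (\<bar>a\<bar> + \<bar>b\<bar>)"
        using linear_lower_bound_of_positive_det by blast
      \<comment> \<open>Of the bound \<open>c0 \<ge> 3 * c\<close> for the true derivatives, at most
        \<open>c\<close> is lost by passing to the rational ones; this leaves the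
        \<open>2 * c\<close> demanded of a piece.\<close>
      obtain n where n: "1 / (real n + 1) < c0 / 3"
        using reals_Archimedean[of "c0 / 3"] c0(1) by (auto simp: inverse_eq_divide add.commute)
      define c where "c = 1 / (real n + 1)"
      have c: "c > 0" "3 * c \<le> c0" using n by (auto simp: c_def)
      obtain p1 q1 where m1: "cmod (C p1 q1 - g1 z) < c / 2"
        using rational_complex_dense[of "c / 2" "g1 z"] c unfolding C_def by auto
      obtain p2 q2 where m2: "cmod (C p2 q2 - g2 z) < c / 2"
        using rational_complex_dense[of "c / 2" "g2 z"] c unfolding C_def by auto
      obtain d1 where d1: "d1 > 0" "\<And>u. \<bar>u - Re z\<bar> < d1 \<Longrightarrow>
          cmod (h (Complex u (Im z)) - h z - (u - Re z) *\<^sub>R C p1 q1) \<le> c * \<bar>u - Re z\<bar>"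
        using vector_derivative_increment[OF g1 c(1), of "C p1 q1"] m1 by auto
      obtain d2 where d2: "d2 > 0" "\<And>u. \<bar>u - Im z\<bar> < d2 \<Longrightarrow>
          cmod (h (Complex (Re z) u) - h z - (u - Im z) *\<^sub>R C p2 q2) \<le> c * \<bar>u - Im z\<bar>"
        using vector_derivative_increment[OF g2 c(1), of "C p2 q2"] m2 by auto
      obtain k where k: "1 / (real k + 1) < min d1 d2"
        using reals_Archimedean[of "min d1 d2"] d1(1) d2(1) by (auto simp: inverse_eq_divide add.commute)
      obtain p3 q3 where m3: "cmod (C p3 q3 - z) < 1 / (2 * (real k + 1))"
        using rational_complex_dense[of "1 / (2 * (real k + 1))" z] unfolding C_def by auto
      have "2 * c * (\<bar>a\<bar> + \<bar>b\<bar>) \<le> cmod (a *\<^sub>R C p1 q1 + b *\<^sub>R C p2 q2)" for a b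
      proof -
        let ?r = "a *\<^sub>R (C p1 q1 - g1 z) + b *\<^sub>R (C p2 q2 - g2 z)"
        have "cmod ?r \<le> \<bar>a\<bar> * c + \<bar>b\<bar> * c"
          by (rule order_trans[OF norm_triangle_ineq])
             (use m1 m2 c in \<open>auto intro!: add_mono mult_left_mono\<close>)
        moreover have "a *\<^sub>R g1 z + b *\<^sub>R g2 z = (a *\<^sub>R C p1 q1 + b *\<^sub>R C p2 q2) - ?r"
          by (simp add: algebra_simps)
        then have "cmod (a *\<^sub>R g1 z + b *\<^sub>R g2 z) \<le> cmod (a *\<^sub>R C p1 q1 + b *\<^sub>R C p2 q2) + cmod ?r"
          by (metis norm_triangle_ineq4)
        moreover have "3 * c * (\<bar>a\<bar> + \<bar>b\<bar>) \<le> c0 * (\<bar>a\<bar> + \<bar>b\<bar>)" using c by (intro mult_right_mono) auto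
        ultimately show ?thesis using c0(2)[of a b] by (simp add: algebra_simps)
      qed
      then have "z \<in> E (n, k, p1, q1, p2, q2, p3, q3)"
        unfolding E_def using z(2) m3 d1(2) d2(2) k by (auto simp: c_def norm_minus_commute)
      then show ?thesis by blast
    qed simp
  qed
  moreover have "negligible (\<Union>i. E i)"
    using nE by (intro negligible_countable_Union) auto
  then have "negligible (?B \<union> (\<Union>i. E i))"
    using nB by simp
  ultimately show ?thesis using negligible_subset by blast
qed

section \<open>Fibres\<close>

lemma eq_singleton_if_subset_cballs:
  fixes F :: "complex set"
  assumes "p \<in> F" "\<And>e. e > 0 \<Longrightarrow> F \<subseteq> cball p e"
  shows "F = {p}"
proof -
  have "z = p" if "z \<in> F" for z
  proof (rule ccontr)
    assume "z \<noteq> p"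
    then have "F \<subseteq> cball p (dist p z / 2)" by (intro assms(2)) simp
    then have "dist p z \<le> dist p z / 2" using that by auto
    then show False using \<open>z \<noteq> p\<close> by simp
  qed
  then show ?thesis using assms(1) by blast
qed

text \<open>A frontier point is outside the open set \<open>X\<close>, hence not above the graph.
  Strictly below the graph it would have a neighbourhood free of \<open>X\<close>, although it lies
  in the closure.\<close>

lemma lipschitz_domain_frontier_graph:
  assumes "open X" "continuous_on UNIV g"
    and X: "X \<inter> ball p r = {z \<in> ball p r. Im (u * (z - p)) > g (Re (u * (z - p)))}"
    and z: "z \<in> frontier X" "z \<in> ball p r"
  shows "Im (u * (z - p)) = g (Re (u * (z - p)))"
proof (rule ccontr)
  assume "Im (u * (z - p)) \<noteq> g (Re (u * (z - p)))"
  moreover have "z \<notin> X" using z(1) assms(1) frontier_disjoint_eq by blast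
  ultimately have lt: "Im (u * (z - p)) < g (Re (u * (z - p)))" using X z(2) by fastforce
  let ?V = "{w. Im (u * (w - p)) < g (Re (u * (w - p)))}"
  have "open ?V"
    by (intro open_Collect_less continuous_intros continuous_on_compose2[OF assms(2)]) auto
  then have "open (ball p r \<inter> ?V)" by auto
  moreover have "z \<in> ball p r \<inter> ?V" using lt z by simp
  moreover have "z \<in> closure X" using z(1) by (simp add: frontier_def)
  ultimately have "X \<inter> (ball p r \<inter> ?V) \<noteq> {}"
    using open_Int_closure_eq_empty[of "ball p r \<inter> ?V" X] by blast
  then obtain w where "w \<in> X" "w \<in> ball p r" "w \<in> ?V" by blast
  then have "w \<in> {z \<in> ball p r. Im (u * (z - p)) > g (Re (u * (z - p)))}" using X by blast
  with \<open>w \<in> ?V\<close> show False by simp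
qed

text \<open>The countable set consists of the boundary points over rational abscissae in finitely many
  graph charts; a connected subset of the boundary missing it cannot spread in any chart.\<close>
lemma lipschitz_domain_boundary_separator:
  assumes bX: "bounded X" and lip: "lipschitz_domain X"
  obtains D where "countable D"
    "\<And>F p. \<lbrakk>F \<subseteq> frontier X; connected F; F \<inter> D = {}; p \<in> F\<rbrakk> \<Longrightarrow> F = {p}"
proof -
  have oX: "open X" using lip by (simp add: lipschitz_domain_def domain_def)
  define K where "K p r u g L \<longleftrightarrow> r > 0 \<and> cmod u = 1 \<and> lipschitz_on L UNIV g \<and>
        X \<inter> ball p r = {z \<in> ball p r. Im (u * (z - p)) > g (Re (u * (z - p)))}"
    for p u :: complex and r L :: real and g :: "real \<Rightarrow> real"
  have "\<forall>p. p \<in> frontier X \<longrightarrow> (\<exists>r u g L. K p r u g L)"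
    using lip unfolding lipschitz_domain_def Ball_def K_def by simp
  then obtain r u g L where "\<And>p. p \<in> frontier X \<Longrightarrow> K p (r p) (u p) (g p) (L p)"
    by metis
  then have chart: "\<And>p. p \<in> frontier X \<Longrightarrow> r p > 0" "\<And>p. p \<in> frontier X \<Longrightarrow> cmod (u p) = 1"
      "\<And>p. p \<in> frontier X \<Longrightarrow> lipschitz_on (L p) UNIV (g p)"
      "\<And>p. p \<in> frontier X \<Longrightarrow> X \<inter> ball p (r p) = {z \<in> ball p (r p). Im (u p * (z - p)) > g p (Re (u p * (z - p)))}"
    unfolding K_def by simp_all
  have "compact (frontier X)" by (rule compact_frontier_bounded[OF bX])
  then obtain P where P: "P \<subseteq> frontier X" "finite P" "frontier X \<subseteq> (\<Union>p\<in>P. ball p (r p))"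
    by (rule compactE_image[of _ "frontier X" "\<lambda>p. ball p (r p)"]) (use chart(1) in auto)
  have graph: "Im (u p * (z - p)) = g p (Re (u p * (z - p)))"
    if "p \<in> P" "z \<in> frontier X" "z \<in> ball p (r p)" for p z
  proof -
    have p: "p \<in> frontier X" using that P by blast
    show ?thesis
      by (rule lipschitz_domain_frontier_graph[OF oX lipschitz_on_continuous_on[OF chart(3)[OF p]] chart(4)[OF p] that(2,3)])
  qed
  \<comment> \<open>On a Lipschitz graph the abscissa controls the distance: the rotation
    \<open>u p\<close> preserves lengths and the ordinate varies at most \<open>L p\<close> times as
    fast.\<close>
  have close: "dist z w \<le> (1 + L p) * \<bar>Re (u p * (z - p)) - Re (u p * (w - p))\<bar>"
    if p: "p \<in> P" and z: "z \<in> frontier X" "z \<in> ball p (r p)" and w: "w \<in> frontier X" "w \<in> ball p (r p)" for p z w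
  proof -
    have p': "p \<in> frontier X" using p P by blast
    let ?R = "\<bar>Re (u p * (z - p)) - Re (u p * (w - p))\<bar>"
    have "dist z w = cmod (u p * (z - p) - u p * (w - p))"
      using chart(2)[OF p'] by (simp add: dist_norm norm_mult flip: right_diff_distrib)
    also have "\<dots> \<le> ?R + \<bar>Im (u p * (z - p)) - Im (u p * (w - p))\<bar>"
      using cmod_le[of "u p * (z - p) - u p * (w - p)"] by simp
    also have "\<bar>Im (u p * (z - p)) - Im (u p * (w - p))\<bar> \<le> L p * ?R"
      unfolding graph[OF p z] graph[OF p w]
      using lipschitz_onD[OF chart(3)[OF p'], of "Re (u p * (z - p))" "Re (u p * (w - p))"]
      by (simp add: dist_real_def)
    finally show ?thesis by (simp add: algebra_simps)
  qed
  define D where "D = (\<Union>p\<in>P. {z \<in> frontier X \<inter> ball p (r p). Re (u p * (z - p)) \<in> \<rat>})"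
  have "countable D"
    unfolding D_def
  proof (intro countable_UN countable_finite[OF P(2)])
    fix p assume p: "p \<in> P"
    let ?S = "{z \<in> frontier X \<inter> ball p (r p). Re (u p * (z - p)) \<in> \<rat>}"
    have "inj_on (\<lambda>z. Re (u p * (z - p))) ?S"
    proof (rule inj_onI)
      fix z w assume "z \<in> ?S" "w \<in> ?S" "Re (u p * (z - p)) = Re (u p * (w - p))"
      then show "z = w" using close[OF p, of z w] by auto
    qed
    moreover have "countable ((\<lambda>z. Re (u p * (z - p))) ` ?S)"
      by (rule countable_subset[OF _ countable_rat]) auto
    ultimately show "countable ?S" by (rule countable_image_inj_on[rotated])
  qed
  moreover have "F = {q}" if F: "F \<subseteq> frontier X" "connected F" "F \<inter> D = {}" "q \<in> F" for F q
  proof (rule eq_singleton_if_subset_cballs[OF F(4)])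
    fix e0 :: real assume e0: "e0 > 0"
    obtain p where p: "p \<in> P" "q \<in> ball p (r p)" using F P by blast
    have p': "p \<in> frontier X" using p P by blast
    obtain e1 where e1: "e1 > 0" "cball q e1 \<subseteq> ball p (r p)"
      using p(2) open_ball open_contains_cball by blast
    define e where "e = min e0 e1"
    have e: "e > 0" "cball q e \<subseteq> ball p (r p)" using e0 e1 by (auto simp: e_def)
    have Lp: "L p \<ge> 0" using chart(3)[OF p'] by (rule lipschitz_on_nonneg)
    define \<rho> where "\<rho> z = Re (u p * (z - p))" for z
    \<comment> \<open>Boundary points of this chart whose abscissae differ by at most \<eta> are at
      distance at most \<open>e / 2\<close>, strictly inside the ball of radius
      \<open>e\<close>.\<close>
    define \<eta> where "\<eta> = (e / 2) / (1 + L p)"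
    have "1 + L p \<noteq> 0" using Lp by linarith
    then have "(1 + L p) * \<eta> = e / 2" unfolding \<eta>_def by (simp del: divide_divide_eq_left)
    moreover have "\<eta> > 0" unfolding \<eta>_def using e Lp by (intro divide_pos_pos) auto
    ultimately have \<eta>: "\<eta> > 0" "(1 + L p) * \<eta> < e" using e by auto
    obtain q1 where q1: "q1 \<in> \<rat>" "\<rho> q - \<eta> < q1" "q1 < \<rho> q"
      using Rats_dense_in_real[of "\<rho> q - \<eta>" "\<rho> q"] \<eta> by auto
    obtain q2 where q2: "q2 \<in> \<rat>" "\<rho> q < q2" "q2 < \<rho> q + \<eta>"
      using Rats_dense_in_real[of "\<rho> q" "\<rho> q + \<eta>"] \<eta> by auto
    \<comment> \<open>A ball cut down to a strip between rational abscissae. A point of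
      \<open>F\<close> on the frontier of \<open>U\<close> is strictly inside the ball by the choice
      of \<eta>, so it lies over \<open>q1\<close> or \<open>q2\<close> and thus in
      \<open>D\<close>. Connectedness then keeps \<open>F\<close> inside \<open>U\<close>.\<close>
    define U where "U = ball q e \<inter> {z. q1 < \<rho> z} \<inter> {z. \<rho> z < q2}"
    have c\<rho>: "continuous_on UNIV \<rho>" unfolding \<rho>_def by (intro continuous_intros)
    have oU: "open U" unfolding U_def
      by (intro open_Int open_Collect_less c\<rho> continuous_on_const open_ball)
    have "closure U \<subseteq> cball q e \<inter> {z. q1 \<le> \<rho> z} \<inter> {z. \<rho> z \<le> q2}"
    proof (rule closure_minimal)
      show "closed (cball q e \<inter> {z. q1 \<le> \<rho> z} \<inter> {z. \<rho> z \<le> q2})"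
        by (intro closed_Int closed_Collect_le c\<rho> continuous_on_const closed_cball)
    qed (auto simp: U_def)
    have "F \<inter> frontier U = {}"
    proof (rule ccontr)
      assume "F \<inter> frontier U \<noteq> {}"
      then obtain z where z: "z \<in> F" "z \<in> closure U" "z \<notin> U"
        using oU by (auto simp: frontier_def interior_open)
      then have zc: "z \<in> cball q e" "q1 \<le> \<rho> z" "\<rho> z \<le> q2"
        using \<open>closure U \<subseteq> _\<close> by auto
      have zb: "z \<in> ball p (r p)" using zc e by blast
      have "\<bar>\<rho> q - \<rho> z\<bar> \<le> \<eta>" using zc q1 q2 by linarith
      have "dist q z \<le> (1 + L p) * \<bar>\<rho> q - \<rho> z\<bar>"
        unfolding \<rho>_def using F z zb p by (intro close) auto
      also have "\<dots> \<le> (1 + L p) * \<eta>" using \<open>\<bar>\<rho> q - \<rho> z\<bar> \<le> \<eta>\<close> Lp by (intro mult_left_mono) auto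
      finally have "z \<in> ball q e" using \<eta>(2) by simp
      with z(3) zc have "\<rho> z = q1 \<or> \<rho> z = q2" by (auto simp: U_def)
      then have "\<rho> z \<in> \<rat>" using q1 q2 by auto
      then have "z \<in> D" using z(1) F(1) zb p by (auto simp: D_def \<rho>_def)
      then show False using z F by blast
    qed
    moreover have "q \<in> F \<inter> U" using F q1 q2 e by (auto simp: U_def)
    ultimately have "F \<subseteq> U" using connected_Int_frontier[OF F(2), of U] by blast
    then show "F \<subseteq> cball q e0" by (auto simp: U_def e_def)
  qed
  ultimately show thesis using that by blast
qed

lemma AE_lborel_dense:
  assumes "AE s in lborel. P s" "x < (y::real)"
  obtains s where "x < s" "s < y" "P s"
proof -
  have "\<not> {x<..<y} \<subseteq> {s. \<not> P s}"
  proof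
    assume "{x<..<y} \<subseteq> {s. \<not> P s}"
    then have "negligible {x<..<y}"
      using AE_lborel_imp_negligible[OF assms(1)] negligible_subset by blast
    then show False using assms(2) negligible_interval(2)[of x y] by simp
  qed
  then show thesis using that by auto
qed

text \<open>Almost all lines are avoidable, so arbitrarily close to \<open>p\<close> there are four
  of them bounding a small box. A connected set through \<open>p\<close> that misses the frontier of
  the box cannot leave it.\<close>

lemma fibre_singleton_of_avoiding_lines:
  assumes X: "open X" and F: "connected F" "p \<in> F" "p \<in> X"
    and hor: "AE s in lborel. \<forall>t. Complex t s \<in> X \<longrightarrow> Complex t s \<notin> F"
    and ver: "AE s in lborel. \<forall>t. Complex s t \<in> X \<longrightarrow> Complex s t \<notin> F"
  shows "F = {p}"
proof (rule eq_singleton_if_subset_cballs[OF F(2)])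
  fix e0 :: real assume e0: "e0 > 0"
  obtain e1 where e1: "e1 > 0" "cball p e1 \<subseteq> X"
    using F(3) X open_contains_cball by blast
  \<comment> \<open>The sides lie within \<open>e\<close> of \<open>p\<close> in each coordinate, so
    the box is within distance \<open>2 * e\<close>. This keeps it inside \<open>X\<close>, where
    the lines are known to be avoided, and inside the target ball.\<close>
  define e where "e = min e0 e1 / 2"
  have e: "e > 0" "2 * e \<le> e0" "2 * e \<le> e1" using e0 e1 by (auto simp: e_def)
  obtain a where a: "Re p - e < a" "a < Re p" "\<And>t. Complex a t \<in> X \<Longrightarrow> Complex a t \<notin> F"
    using AE_lborel_dense[OF ver, of "Re p - e" "Re p"] e by auto
  obtain b where b: "Re p < b" "b < Re p + e" "\<And>t. Complex b t \<in> X \<Longrightarrow> Complex b t \<notin> F"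
    using AE_lborel_dense[OF ver, of "Re p" "Re p + e"] e by auto
  obtain c where c: "Im p - e < c" "c < Im p" "\<And>t. Complex t c \<in> X \<Longrightarrow> Complex t c \<notin> F"
    using AE_lborel_dense[OF hor, of "Im p - e" "Im p"] e by auto
  obtain d where d: "Im p < d" "d < Im p + e" "\<And>t. Complex t d \<in> X \<Longrightarrow> Complex t d \<notin> F"
    using AE_lborel_dense[OF hor, of "Im p" "Im p + e"] e by auto
  let ?l = "Complex a c" and ?u = "Complex b d"
  have small: "dist p z \<le> 2 * e" if "z \<in> cbox ?l ?u" for z
  proof -
    have "dist p z \<le> \<bar>Re p - Re z\<bar> + \<bar>Im p - Im z\<bar>"
      using cmod_le[of "p - z"] by (simp add: dist_norm)
    moreover have "\<bar>Re p - Re z\<bar> \<le> e" "\<bar>Im p - Im z\<bar> \<le> e"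
      using that a b c d by (auto simp: in_cbox_complex_iff abs_le_iff)
    ultimately show ?thesis by simp
  qed
  have "F \<inter> frontier (box ?l ?u) = {}"
  proof (rule ccontr)
    assume "F \<inter> frontier (box ?l ?u) \<noteq> {}"
    then obtain z where z: "z \<in> F" "z \<in> frontier (box ?l ?u)" by blast
    have "frontier (box ?l ?u) \<subseteq> cbox ?l ?u - box ?l ?u"
      unfolding frontier_def using closure_minimal[OF box_subset_cbox closed_cbox, of ?l ?u]
      by (auto simp: interior_open open_box)
    with z have zc: "z \<in> cbox ?l ?u" "z \<notin> box ?l ?u" by auto
    have "z \<in> cball p e1" using small[OF zc(1)] e by simp
    then have zX: "Complex (Re z) (Im z) \<in> X" using e1 by auto
    have "Re z = a \<or> Re z = b \<or> Im z = c \<or> Im z = d"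
      using zc by (auto simp: in_cbox_complex_iff in_box_complex_iff)
    then have "Complex (Re z) (Im z) \<notin> F"
      using zX a(3) b(3) c(3) d(3) by metis
    with z show False by simp
  qed
  moreover have "p \<in> F \<inter> box ?l ?u" using F a b c d by (auto simp: in_box_complex_iff)
  ultimately have "F \<subseteq> box ?l ?u" using connected_Int_frontier[OF F(1), of "box ?l ?u"] by blast
  then show "F \<subseteq> cball p e0"
    using small e box_subset_cbox[of ?l ?u] by fastforce
qed

theorem theorem1p8:
  fixes X Y :: "complex set" and h g1 g2 :: "complex \<Rightarrow> complex"
  assumes "bounded X" "lipschitz_domain X" "finitely_connected X"
    and "bounded Y" "lipschitz_domain Y" "finitely_connected Y"
    and "morrey_monotone h (closure X) (closure Y)"
    and "h ` closure X = closure Y"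
    and "sobolev_W12 X h g1 g2"
    and "AE z in lebesgue. z \<in> X \<longrightarrow> jacobian g1 g2 z > 0"
  shows "closure Y - {y \<in> h ` closure X. \<exists>!x. x \<in> closure X \<and> h x = y} \<in> null_sets lebesgue \<and>
         (\<exists>Xh \<subseteq> X. X - Xh \<in> null_sets lebesgue \<and> inj_on h Xh)"
proof -
  have oX: "open X" using assms(2) by (simp add: lipschitz_domain_def domain_def)
  have cX: "continuous_on X h"
    using assms(7) closure_subset by (auto simp: morrey_monotone_def intro: continuous_on_subset)
  have wp: "weak_partial X 1 h g1" "weak_partial X \<i> h g2" "L2_on X g1" "L2_on X g2"
    using assms(9) by (auto simp: sobolev_W12_def)
  have fr1: "axis_frame 1 (\<lambda>p. Complex (snd p) (fst p)) Im Re"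
    and fr2: "axis_frame \<i> (\<lambda>p. Complex (fst p) (snd p)) Re Im"
    by (auto simp: axis_frame_def)
  obtain D where D: "countable D"
    "\<And>F p. \<lbrakk>F \<subseteq> frontier X; connected F; F \<inter> D = {}; p \<in> F\<rbrakk> \<Longrightarrow> F = {p}"
    using lipschitz_domain_boundary_separator[OF assms(1,2)] by blast
  define fib where "fib y = {x \<in> closure X. h x = y}" for y
  \<comment> \<open>Monotonicity enters through singletons, which are continua.\<close>
  have conn: "connected (fib y)" if "y \<in> closure Y" for y
  proof -
    have "continuum {y}" by (simp add: continuum_def)
    then have "continuum {x \<in> closure X. h x \<in> {y}}"
      using assms(7) that unfolding morrey_monotone_def by blast
    then show ?thesis by (simp add: continuum_def fib_def)
  qed
  define bad where "bad = closure Y - {y \<in> h ` closure X. \<exists>!x. x \<in> closure X \<and> h x = y}"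
  \<comment> \<open>The values in the image of \<open>D\<close> under \<open>h\<close> are set
    aside: they are countably many, and they account for every nondegenerate fibre inside the
    frontier.\<close>
  have "AE y in lborel. y \<in> closure Y \<longrightarrow> y \<notin> h ` D \<longrightarrow> (\<exists>!x. x \<in> closure X \<and> h x = y)"
    using fibres_avoid_almost_all_lines[OF fr1 oX assms(1) cX wp(1,3)]
      fibres_avoid_almost_all_lines[OF fr2 oX assms(1) cX wp(2,4)]
  proof eventually_elim
    case (elim y)
    show ?case
    proof (intro impI)
      assume y: "y \<in> closure Y" "y \<notin> h ` D"
      obtain p where p: "p \<in> fib y" using y(1) unfolding assms(8)[symmetric] fib_def by blast
      have "\<exists>p. fib y = {p}"
      \<comment> \<open>A fibre that meets \<open>X\<close> might also reach the frontier; the small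
        boxes around its interior point \<open>q\<close> lie in \<open>X\<close> and exclude this
        too.\<close>
      proof (cases "fib y \<inter> X = {}")
        case True
        then have "fib y \<subseteq> frontier X"
          using oX by (auto simp: fib_def frontier_def interior_open)
        moreover have "fib y \<inter> D = {}" using y(2) by (auto simp: fib_def)
        ultimately show ?thesis using D(2) conn[OF y(1)] p by blast
      next
        case False
        then obtain q where q: "q \<in> fib y" "q \<in> X" by blast
        have "fib y = {q}"
        proof (rule fibre_singleton_of_avoiding_lines[OF oX conn[OF y(1)] q])
          show "AE s in lborel. \<forall>t. Complex t s \<in> X \<longrightarrow> Complex t s \<notin> fib y"
            using elim(1) by eventually_elim (simp add: fib_def)
          show "AE s in lborel. \<forall>t. Complex s t \<in> X \<longrightarrow> Complex s t \<notin> fib y"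
            using elim(2) by eventually_elim (simp add: fib_def)
        qed
        then show ?thesis by blast
      qed
      then show "\<exists>!x. x \<in> closure X \<and> h x = y"
        unfolding fib_def by (metis (mono_tags, lifting) mem_Collect_eq singleton_iff)
    qed
  qed
  then have "negligible {y. \<not> (y \<in> closure Y \<longrightarrow> y \<notin> h ` D \<longrightarrow> (\<exists>!x. x \<in> closure X \<and> h x = y))}" (is "negligible ?N")
    by (rule AE_lborel_imp_negligible)
  moreover have "negligible (h ` D)" 
    using countable_imp_null_set_lborel[of "h ` D"] D(1)
    by (auto simp: negligible_iff_null_sets intro: null_sets_completionI)
  ultimately have "negligible (?N \<union> h ` D)" by simp
  moreover have "bad \<subseteq> ?N \<union> h ` D"
    unfolding bad_def assms(8) by blast
  ultimately have bad: "negligible bad" by (rule negligible_subset)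
  have J: "AE z in lborel. z \<in> X \<longrightarrow> jacobian g1 g2 z > 0"
    using assms(10) by (simp add: AE_completion_iff)
  \<comment> \<open>By this, the points of \<open>X\<close> over good values have full measure and
    can serve as \<open>Xh\<close>; there injectivity is the uniqueness of the preimage.\<close>
  have "negligible {z \<in> X. h z \<in> bad}"
    by (rule negligible_preimage[OF bad _ _ J])
       (use weak_partial_is_partial_ae[OF fr1 oX assms(1) cX wp(1,3)]
          weak_partial_is_partial_ae[OF fr2 oX assms(1) cX wp(2,4)] in simp_all)
  moreover have "X - {z \<in> X. h z \<notin> bad} = {z \<in> X. h z \<in> bad}" by blast
  moreover have "inj_on h {z \<in> X. h z \<notin> bad}"
  proof (rule inj_onI)
    fix z w assume *: "z \<in> {z \<in> X. h z \<notin> bad}" "w \<in> {z \<in> X. h z \<notin> bad}" "h z = h w"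
    then have zw: "z \<in> closure X" "w \<in> closure X" using closure_subset by auto
    then have "h z \<in> closure Y" using assms(8) by blast
    with * have "\<exists>!x. x \<in> closure X \<and> h x = h z" by (auto simp: bad_def)
    with zw *(3) show "z = w" by metis
  qed
  ultimately have "\<exists>Xh\<subseteq>X. X - Xh \<in> null_sets lebesgue \<and> inj_on h Xh"
    by (intro exI[of _ "{z \<in> X. h z \<notin> bad}"]) (auto simp: negligible_iff_null_sets)
  with bad show ?thesis
    unfolding bad_def negligible_iff_null_sets by blast
qed

end
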